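(* Consider the urn model described in the context, and assume that there is an integer constant $C$ with $A_n\vee B_n\vee N_n\le C$ for all $n\ge 1$, and that $m_{A,n}=E[A_n]\to m_A\in(0,+\infty)$ and $m_{B,n}=E[B_n]\to m_B\in(0,+\infty)$ as $n\to\infty$. If $m_A>m_B$, then $Z_n\to Z=1$ almost surely.
   Context: Urn model. An urn initially contains $a\ge 1$ balls of color A and $b\ge 1$ balls of color B ($a,b$ integers). On a probability space $(\Omega,\mathcal A,P)$ there are random variables $N_n,X_n,A_n,B_n$, $n\ge 1$, where $N_n$ is the size of the sample drawn without replacement at time $n$, $X_n$ is the number of sampled balls of color A, and after the draw the sampled balls are returned together with $A_nX_n$ new balls of color A and $B_n(N_n-X_n)$ new balls of color B. Put, for $n\ge 0$, $H_n=a+\sum_{j=1}^n A_jX_j$ (balls of color A), $K_n=b+\sum_{j=1}^n B_j(N_j-X_j)$ (balls of color B), $S_n=H_n+K_n$. For each $n\ge1$: (A1) the conditional distribution of $N_n$ given $[N_1,X_1,A_1,B_1,\dots,N_{n-1},X_{n-1},A_{n-1},B_{n-1}]$ is concentrated on $\{1,\dots,S_{n-1}\}$; (A2) the conditional distribution of $X_n$ given $[N_1,X_1,A_1,B_1,\dots,N_{n-1},X_{n-1},A_{n-1},B_{n-1},N_n]$ is hypergeometric with parameters $N_n,S_{n-1},H_{n-1}$, i.e. it gives mass $\binom{H_{n-1}}{k}\binom{S_{n-1}-H_{n-1}}{N_n-k}/\binom{S_{n-1}}{N_n}$ to $k$; (A3) the random vector $[A_n,B_n]$ takes values in $(\mathbb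 N\setminus\{0\})^2$ and is independent of $[N_1,X_1,A_1,B_1,\dots,N_{n-1},X_{n-1},A_{n-1},B_{n-1},N_n,X_n]$ ($A_n$ and $B_n$ may be correlated with each other and their law may depend on $n$). The proportion of balls of color A is $Z_n=H_n/S_n$, $n\ge0$. *)

theory Defs
  imports "HOL-Probability.Probability"
begin

text \<open>
  Every sequence \<open>N, X, A, B\<close> is indexed from 1; its entry at index 0 is never used. The subtraction
  \<open>N j \<omega> - X j \<omega>\<close> is on \<open>nat\<close>, but in the urn model below \<open>X j \<le> N j\<close> holds almost surely, so that
  truncation takes place on a null set only.
\<close>

definition balls_A :: "nat \<Rightarrow> (nat \<Rightarrow> 'w \<Rightarrow> nat) \<Rightarrow> (nat \<Rightarrow> 'w \<Rightarrow> nat) \<Rightarrow> nat \<Rightarrow> 'w \<Rightarrow> nat" where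
  "balls_A a X A n \<omega> = a + (\<Sum>j=1..n. A j \<omega> * X j \<omega>)"

definition balls_B ::
  "nat \<Rightarrow> (nat \<Rightarrow> 'w \<Rightarrow> nat) \<Rightarrow> (nat \<Rightarrow> 'w \<Rightarrow> nat) \<Rightarrow> (nat \<Rightarrow> 'w \<Rightarrow> nat) \<Rightarrow> nat \<Rightarrow> 'w \<Rightarrow> nat" where
  "balls_B b N X B n \<omega> = b + (\<Sum>j=1..n. B j \<omega> * (N j \<omega> - X j \<omega>))"

definition balls_total ::
  "nat \<Rightarrow> nat \<Rightarrow> (nat \<Rightarrow> 'w \<Rightarrow> nat) \<Rightarrow> (nat \<Rightarrow> 'w \<Rightarrow> nat) \<Rightarrow> (nat \<Rightarrow> 'w \<Rightarrow> nat) \<Rightarrow> (nat \<Rightarrow> 'w \<Rightarrow> nat)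
    \<Rightarrow> nat \<Rightarrow> 'w \<Rightarrow> nat" where
  "balls_total a b N X A B n \<omega> = balls_A a X A n \<omega> + balls_B b N X B n \<omega>"

definition proportion_A ::
  "nat \<Rightarrow> nat \<Rightarrow> (nat \<Rightarrow> 'w \<Rightarrow> nat) \<Rightarrow> (nat \<Rightarrow> 'w \<Rightarrow> nat) \<Rightarrow> (nat \<Rightarrow> 'w \<Rightarrow> nat) \<Rightarrow> (nat \<Rightarrow> 'w \<Rightarrow> nat)
    \<Rightarrow> nat \<Rightarrow> 'w \<Rightarrow> real" where
  "proportion_A a b N X A B n \<omega> = real (balls_A a X A n \<omega>) / real (balls_total a b N X A B n \<omega>)"

text \<open>
  Mass at \<open>k\<close> of the number of marked balls in a sample of size \<open>N\<close>, drawn without replacement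
  from \<open>S\<close> balls of which \<open>H\<close> are marked. The guard is needed because \<open>N - k = 0\<close> on \<open>nat\<close>
  for \<open>k > N\<close>.
\<close>

definition hypergeometric_mass :: "nat \<Rightarrow> nat \<Rightarrow> nat \<Rightarrow> nat \<Rightarrow> real" where
  "hypergeometric_mass N S H k =
    (if k \<le> N then real (H choose k) * real ((S - H) choose (N - k)) / real (S choose N) else 0)"

text \<open>
  The vector \<open>[N\<^sub>1, X\<^sub>1, A\<^sub>1, B\<^sub>1, \<dots>, N\<^sub>n\<^sub>-\<^sub>1, X\<^sub>n\<^sub>-\<^sub>1, A\<^sub>n\<^sub>-\<^sub>1, B\<^sub>n\<^sub>-\<^sub>1]\<close>, with values in \<open>history_space n\<close>.
\<close>

definition history ::
  "(nat \<Rightarrow> 'w \<Rightarrow> nat) \<Rightarrow> (nat \<Rightarrow> 'w \<Rightarrow> nat) \<Rightarrow> (nat \<Rightarrow> 'w \<Rightarrow> nat) \<Rightarrow> (nat \<Rightarrow> 'w \<Rightarrow> nat)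
    \<Rightarrow> nat \<Rightarrow> 'w \<Rightarrow> nat \<Rightarrow> nat \<times> nat \<times> nat \<times> nat" where
  "history N X A B n \<omega> = (\<lambda>j\<in>{1..<n}. (N j \<omega>, X j \<omega>, A j \<omega>, B j \<omega>))"

definition history_space :: "nat \<Rightarrow> (nat \<Rightarrow> nat \<times> nat \<times> nat \<times> nat) measure" where
  "history_space n = (\<Pi>\<^sub>M j\<in>{1..<n}. count_space UNIV)"

text \<open>
  \<open>cond_mass M L V Y k\<close> is (a version of) the mass that the conditional distribution of the
  \<open>nat\<close>-valued \<open>Y\<close> given the random element \<open>V\<close> of \<open>L\<close> assigns to \<open>k\<close>.
\<close>

definition cond_mass ::
  "'w measure \<Rightarrow> 'v measure \<Rightarrow> ('w \<Rightarrow> 'v) \<Rightarrow> ('w \<Rightarrow> nat) \<Rightarrow> nat \<Rightarrow> 'w \<Rightarrow> real" where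
  "cond_mass M L V Y k =
    real_cond_exp M (vimage_algebra (space M) V L) (indicator {\<omega> \<in> space M. Y \<omega> = k})"

text \<open>
  Independence is stated for the generated \<open>\<sigma>\<close>-algebras because \<^const>\<open>prob_space.indep_var\<close> requires
  both random elements to have the same type.
\<close>

locale urn_model = prob_space M
  for M :: "'w measure" +
  fixes a b :: nat
    and N X A B :: "nat \<Rightarrow> 'w \<Rightarrow> nat"
  assumes a_ge_1: "a \<ge> 1"
    and b_ge_1: "b \<ge> 1"
    and measurable_N: "n \<ge> 1 \<Longrightarrow> N n \<in> measurable M (count_space UNIV)"
    and measurable_X: "n \<ge> 1 \<Longrightarrow> X n \<in> measurable M (count_space UNIV)"
    and measurable_A: "n \<ge> 1 \<Longrightarrow> A n \<in> measurable M (count_space UNIV)"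
    and measurable_B: "n \<ge> 1 \<Longrightarrow> B n \<in> measurable M (count_space UNIV)"
    and sample_size: "n \<ge> 1 \<Longrightarrow>
      AE \<omega> in M. (\<Sum>m = 1..balls_total a b N X A B (n - 1) \<omega>.
        cond_mass M (history_space n) (history N X A B n) (N n) m \<omega>) = 1"
    and sample_hypergeometric: "n \<ge> 1 \<Longrightarrow>
      AE \<omega> in M. cond_mass M (history_space n \<Otimes>\<^sub>M count_space UNIV)
          (\<lambda>\<omega>. (history N X A B n \<omega>, N n \<omega>)) (X n) k \<omega>
        = hypergeometric_mass (N n \<omega>) (balls_total a b N X A B (n - 1) \<omega>) (balls_A a X A (n - 1) \<omega>) k"
    and reinforcement_pos: "n \<ge> 1 \<Longrightarrow> \<omega> \<in> space M \<Longrightarrow> A n \<omega> \<ge> 1 \<and> B n \<omega> \<ge> 1"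
    and reinforcement_indep: "n \<ge> 1 \<Longrightarrow>
      indep_set
        (sets (vimage_algebra (space M) (\<lambda>\<omega>. (A n \<omega>, B n \<omega>)) (count_space UNIV)))
        (sets (vimage_algebra (space M) (\<lambda>\<omega>. (history N X A B n \<omega>, N n \<omega>, X n \<omega>))
          (history_space n \<Otimes>\<^sub>M count_space UNIV \<Otimes>\<^sub>M count_space UNIV)))"

end

theory Submission
  imports Defs
begin

text \<open>
  Write \<open>V\<^sub>n = K\<^sub>n / H\<^sub>n\<close>. Expanding \<open>1 / (H\<^sub>n + A X)\<close> to second order, averaging over the
  hypergeometric \<open>X\<close> (mean \<open>N H\<^sub>n / S\<^sub>n\<close>) and using the independence of \<open>[A, B]\<close>, one finds that
  given the past \<open>V\<^sub>n\<^sub>+\<^sub>1\<close> has mean at most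
  \<open>(1 + (m\<^sub>B - (1 - C\<^sup>2 / H\<^sub>n) m\<^sub>A) E[N] / S\<^sub>n) V\<^sub>n\<close>. As \<open>S\<^sub>n\<close> grows at most linearly, once \<open>H\<^sub>n\<close> and
  \<open>n\<close> are large \<open>V\<close> is a nonnegative supermartingale contracted by \<open>1 - \<kappa> / n\<close>, so its mean
  tends to \<open>0\<close>, and a maximal inequality turns this into almost sure convergence. That \<open>H\<^sub>n\<close>
  eventually exceeds any level \<open>h\<close> follows from the same contraction for the mean of the positive part
  of \<open>h - H\<^sub>n\<close>.
\<close>

text \<open>The ratio K/H is chosen because, given the past and \<open>N\<close>, both first-order
  terms of its increment average to the same quantity: the mean of \<open>(N - X) / H\<close> and
  that of \<open>K * X / H^2\<close> are both \<open>(N / S) * (K / H)\<close>. The drift is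
  therefore this common factor times a difference of the means of \<open>B\<close> and
  \<open>A\<close>. The law of \<open>N\<close> is known only through its support, but the factor
  \<open>N / S\<close> only has to be bounded below, by \<open>1 / S\<close>. No term of the bound
  contains both \<open>A\<close> and \<open>B\<close>, so their correlation never enters.

  The obstacle is the remainder, which costs a fraction \<open>C^2 / H\<close> of the mean of
  \<open>A\<close>. For a small gap between the two means the drift is known to be negative only
  above some level \<open>h0\<close> of \<open>H\<close>, and that level is reached at a random
  time. Instead of stopping there, the argument is restricted to the event
  \<open>h0 \<le> H m\<close> for a fixed \<open>m\<close>: it belongs to the past from
  \<open>m\<close> on and \<open>H\<close> never decreases. Countably many such events cover almost
  every outcome.\<close>

section \<open>Deterministic estimates\<close>

text \<open>By \<open>1 - x \<le> exp (- x)\<close> the contraction factors multiply to at most the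
  exponential of \<open>\<kappa>\<close> times a difference of harmonic numbers, and the harmonic
  series diverges. A factor may be negative for small \<open>n\<close>; the exponential bound covers
  this too, since \<open>e\<close> is nonnegative.\<close>

lemma tendsto_0_of_harmonic_contraction:
  fixes e :: "nat \<Rightarrow> real"
  assumes nonneg: "\<And>n. e n \<ge> 0" and "\<kappa> > 0"
    and step: "\<And>n. n \<ge> n0 \<Longrightarrow> e (Suc n) \<le> (1 - \<kappa> / real (Suc n)) * e n"
  shows "e \<longlonglongrightarrow> 0"
proof -
  have bound: "e n \<le> e n0 * exp (\<kappa> * harm n0 - \<kappa> * harm n)" if "n \<ge> n0" for n
    using that
  proof (induction n rule: dec_induct)
    case base
    then show ?case by simp
  next
    case (step n)
    have "e (Suc n) \<le> (1 - \<kappa> / real (Suc n)) * e n"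
      using assms(3) step by simp
    also have "\<dots> \<le> exp (- \<kappa> / real (Suc n)) * e n"
      using exp_ge_add_one_self[of "- \<kappa> / real (Suc n)"] nonneg[of n]
      by (intro mult_right_mono) auto
    also have "\<dots> \<le> exp (- \<kappa> / real (Suc n)) * (e n0 * exp (\<kappa> * harm n0 - \<kappa> * harm n))"
      using step by (intro mult_left_mono) auto
    also have "\<dots> = e n0 * exp (\<kappa> * harm n0 - \<kappa> * harm (Suc n))"
      by (simp add: harm_Suc field_simps flip: exp_add)
    finally show ?case .
  qed
  have "filterlim (\<lambda>n. \<kappa> * harm n) at_top sequentially"
    using harm_at_top \<open>\<kappa> > 0\<close> by (rule filterlim_tendsto_pos_mult_at_top[OF tendsto_const, rotated])
  then have "filterlim (\<lambda>n. \<kappa> * harm n0 - \<kappa> * harm n) at_bot sequentially"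
    using filterlim_tendsto_add_at_top[OF tendsto_const[of "- (\<kappa> * harm n0)"]]
    by (subst filterlim_uminus_at_bot) fastforce
  then have "(\<lambda>n. exp (\<kappa> * harm n0 - \<kappa> * harm n)) \<longlonglongrightarrow> 0"
    by (rule filterlim_compose[OF exp_at_bot])
  then have "(\<lambda>n. e n0 * exp (\<kappa> * harm n0 - \<kappa> * harm n)) \<longlonglongrightarrow> 0"
    by (rule tendsto_mult_right_zero)
  then show ?thesis
    by (rule Lim_null_comparison[rotated])
      (use bound nonneg in \<open>auto intro!: eventually_sequentiallyI[of n0]\<close>)
qed

text \<open>Absorption, \<open>k * (H choose k) = H * (h choose (k - 1))\<close> with
  \<open>H = Suc h\<close>, reduces the sum to Vandermonde's identity; a second absorption
  simplifies the quotient by \<open>(H + K) choose N\<close>, which is nonzero because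
  \<open>N \<le> H + K\<close>.\<close>

lemma hypergeometric_mean:
  assumes "1 \<le> N" and "N \<le> H + K"
  shows "(\<Sum>k\<le>N. real k * hypergeometric_mass N (H + K) H k) = real N * real H / real (H + K)"
proof (cases H)
  case 0
  have "real k * hypergeometric_mass N (H + K) H k = 0" for k
    using 0 by (cases k) (auto simp: hypergeometric_mass_def)
  then have "(\<Sum>k\<le>N. real k * hypergeometric_mass N (H + K) H k) = 0"
    by (intro sum.neutral) blast
  then show ?thesis using 0 by simp
next
  case (Suc h)
  obtain m where m: "N = Suc m" using assms(1) by (cases N) auto
  have pos: "(H + K) choose N > 0" using assms by simp
  have "(\<Sum>k\<le>N. k * ((H choose k) * (K choose (N - k))))
      = (\<Sum>k\<le>m. Suc k * ((Suc h choose Suc k) * (K choose (m - k))))"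
    by (simp add: m Suc sum.atMost_Suc_shift del: binomial_Suc_Suc mult_Suc sum.atMost_Suc)
  also have "\<dots> = (\<Sum>k\<le>m. H * ((h choose k) * (K choose (m - k))))"
    by (intro sum.cong refl) (simp only: mult.assoc[symmetric] Suc_times_binomial Suc)
  also have "\<dots> = H * ((h + K) choose m)"
    by (simp add: sum_distrib_left[symmetric] vandermonde)
  finally have eq: "(\<Sum>k\<le>N. k * ((H choose k) * (K choose (N - k)))) = H * ((h + K) choose m)" .
  have "N * ((H + K) choose N) = (H + K) * ((h + K) choose m)"
    using Suc_times_binomial[of m "h + K"] by (simp add: m Suc del: binomial_Suc_Suc mult_Suc)
  then have eq2: "real N * real ((H + K) choose N) = real (H + K) * real ((h + K) choose m)"
    by (metis of_nat_mult)
  have "(\<Sum>k\<le>N. real k * hypergeometric_mass N (H + K) H k)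
      = real (\<Sum>k\<le>N. k * ((H choose k) * (K choose (N - k)))) / real ((H + K) choose N)"
    by (simp add: hypergeometric_mass_def sum_divide_distrib)
  also have "\<dots> = real H * real ((h + K) choose m) / real ((H + K) choose N)"
    by (simp only: eq of_nat_mult)
  also have "\<dots> = real N * real H / real (H + K)"
    using pos Suc eq2
    by (subst frac_eq_eq) (auto simp del: of_nat_add binomial_Suc_Suc simp: mult.assoc mult.left_commute mult.commute)
  finally show ?thesis .
qed

text \<open>The remainder of the second-order expansion of \<open>1 / (h + x)\<close> is absorbed
  into the first-order term by \<open>x / h \<le> c / h0\<close>. In the \<open>y\<close> term the
  growth of the denominator is dropped, so that no product of \<open>x\<close> and \<open>y\<close>
  arises. With \<open>x = A * X\<close> and \<open>y = B * (N - X)\<close>, each term then contains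
  at most one of \<open>A\<close> and \<open>B\<close>.\<close>

lemma ratio_step_bound:
  fixes h k x y :: real
  assumes "h \<ge> h0" "h0 \<ge> 1" "k \<ge> 0" "0 \<le> x" "x \<le> c" "0 \<le> y"
  shows "(k + y) / (h + x) \<le> k / h + y / h - (1 - c / h0) * (k * x / h\<^sup>2)"
proof -
  have h: "h \<ge> 1" using assms by simp
  have "1 / (h + x) \<le> 1 / h - x / h\<^sup>2 + x\<^sup>2 / h ^ 3"
  proof -
    \<comment> \<open>Multiplied out, the truncated expansion exceeds \<open>1\<close> by exactly
      \<open>(x / h) ^ 3\<close>.\<close>
    have "1 = (h + x) * (1 / h - x / h\<^sup>2 + x\<^sup>2 / h ^ 3) - x ^ 3 / h ^ 3"
      using h by (simp add: field_simps power2_eq_square power3_eq_cube)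
    moreover have "x ^ 3 / h ^ 3 \<ge> 0" using h assms by simp
    ultimately have "1 \<le> (h + x) * (1 / h - x / h\<^sup>2 + x\<^sup>2 / h ^ 3)"
      by linarith
    then show ?thesis using h assms by (simp add: pos_divide_le_eq mult.commute)
  qed
  also have "x\<^sup>2 / h ^ 3 = (x / h) * (x / h\<^sup>2)"
    by (simp add: power2_eq_square power3_eq_cube)
  also have "(x / h) * (x / h\<^sup>2) \<le> (c / h0) * (x / h\<^sup>2)"
    using assms h by (intro mult_right_mono frac_le) auto
  finally have inv: "1 / (h + x) \<le> 1 / h - (1 - c / h0) * (x / h\<^sup>2)"
    unfolding left_diff_distrib mult_1_left by linarith
  have "(k + y) / (h + x) = k * (1 / (h + x)) + y / (h + x)"
    by (simp add: add_divide_distrib)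
  also have "\<dots> \<le> k * (1 / h - (1 - c / h0) * (x / h\<^sup>2)) + y / h"
    using assms h by (intro add_mono mult_left_mono inv divide_left_mono) auto
  finally show ?thesis by (simp add: algebra_simps)
qed

section \<open>Nonnegative supermartingales with vanishing means\<close>

context prob_space
begin

text \<open>The supermartingale property is expressed by integrals over events of
  \<open>F n\<close>, and only from time \<open>k\<close> on. The proof replaces a stopping time by
  the events \<open>D n\<close> that \<open>\<epsilon>\<close> has not been reached between
  \<open>k\<close> and \<open>n\<close>: the sum of \<open>\<epsilon> * prob (space M - D n)\<close>
  and the integral of \<open>V n\<close> over \<open>D n\<close> stays below the mean of
  \<open>V k\<close>.\<close>

lemma supermartingale_maximal:
  fixes V :: "nat \<Rightarrow> 'a \<Rightarrow> real"
  assumes sub: "\<And>n. subalgebra M (F n)" and mono: "\<And>n. subalgebra (F (Suc n)) (F n)"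
    and meas: "\<And>n. V n \<in> borel_measurable (F n)"
    and int: "\<And>n. integrable M (V n)" and nonneg: "\<And>n \<omega>. V n \<omega> \<ge> 0"
    and super: "\<And>n D. k \<le> n \<Longrightarrow> D \<in> sets (F n) \<Longrightarrow>
      (\<integral>\<omega>. indicator D \<omega> * V (Suc n) \<omega> \<partial>M) \<le> (\<integral>\<omega>. indicator D \<omega> * V n \<omega> \<partial>M)"
    and "\<epsilon> > 0"
  shows "prob {\<omega> \<in> space M. \<exists>n\<ge>k. V n \<omega> \<ge> \<epsilon>} \<le> (\<integral>\<omega>. V k \<omega> \<partial>M) / \<epsilon>"
proof -
  define D where "D n = {\<omega> \<in> space M. \<forall>j\<in>{k..n}. V j \<omega> < \<epsilon>}" for n
  have spF: "space (F n) = space M" for n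
    using sub unfolding subalgebra_def by auto
  have measFF: "V j \<in> borel_measurable (F n)" if "j \<le> n" for j n
    using that
  proof (induction n rule: dec_induct)
    case base show ?case by (rule meas)
  next
    case (step n) then show ?case using measurable_from_subalg[OF mono] by blast
  qed
  have D_F: "D n \<in> sets (F n)" for n
  proof -
    have "{\<omega> \<in> space (F n). \<forall>j\<in>{k..n}. V j \<omega> < \<epsilon>} \<in> sets (F n)"
    proof (rule sets.sets_Collect_finite_All[OF _ finite_atLeastAtMost])
      fix j assume "j \<in> {k..n}"
      then have [measurable]: "V j \<in> borel_measurable (F n)" using measFF by auto
      show "{\<omega> \<in> space (F n). V j \<omega> < \<epsilon>} \<in> sets (F n)" by measurable
    qed
    then show ?thesis by (simp add: D_def spF)
  qed
  have D_M [measurable]: "D n \<in> events" for n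
    using D_F sub unfolding subalgebra_def by auto
  have [measurable]: "V n \<in> borel_measurable M" for n
    using int by auto
  have int_ind: "integrable M (\<lambda>\<omega>. indicator G \<omega> * V n \<omega>)" if "G \<in> events" for G n
    using integrable_mult_indicator[OF that int] by simp
  have int_const: "integrable M (\<lambda>\<omega>. \<epsilon> * indicator G \<omega>)" if "G \<in> events" for G
    using that by (auto simp: less_top[symmetric])
  have ineq: "\<epsilon> * prob (space M - D n) + (\<integral>\<omega>. indicator (D n) \<omega> * V n \<omega> \<partial>M) \<le> (\<integral>\<omega>. V k \<omega> \<partial>M)"
    if "n \<ge> k" for n
    using that
  proof (induction n rule: dec_induct)
    case base
    have "\<epsilon> * prob (space M - D k) = (\<integral>\<omega>. \<epsilon> * indicator (space M - D k) \<omega> \<partial>M)"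
      by simp
    then have "\<epsilon> * prob (space M - D k) + (\<integral>\<omega>. indicator (D k) \<omega> * V k \<omega> \<partial>M)
        = (\<integral>\<omega>. \<epsilon> * indicator (space M - D k) \<omega> + indicator (D k) \<omega> * V k \<omega> \<partial>M)"
      by (subst Bochner_Integration.integral_add) (auto intro!: int_ind simp: finite_measure.emeasure_finite less_top[symmetric])
    also have "\<dots> \<le> (\<integral>\<omega>. V k \<omega> \<partial>M)"
      using nonneg int
      by (intro integral_mono Bochner_Integration.integrable_add int_ind int_const)
        (auto split: split_indicator, auto simp: D_def)
    finally show ?case .
  next
    case (step n)
    have split: "space M - D (Suc n) = (space M - D n) \<union> (D n - D (Suc n))"
      using step.hyps by (auto simp: D_def)
    have p: "prob (space M - D (Suc n)) = prob (space M - D n) + prob (D n - D (Suc n))"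
      unfolding split by (rule finite_measure_Union) auto
    have D_anti: "\<omega> \<in> D n" if "\<omega> \<in> D (Suc n)" for \<omega>
      using that by (auto simp: D_def)
    have exit: "V (Suc n) \<omega> \<ge> \<epsilon>" if "\<omega> \<in> D n" "\<omega> \<notin> D (Suc n)" for \<omega>
      using that unfolding D_def by (auto simp: le_Suc_eq not_less) (metis atLeastAtMost_iff not_le)
    \<comment> \<open>Paths that leave \<open>D n\<close> at time \<open>Suc n\<close> move from the
      integral to the probability; there \<open>V (Suc n)\<close> is at least
      \<open>\<epsilon>\<close>, which pays for the transfer.\<close>
    have "\<epsilon> * prob (D n - D (Suc n)) + (\<integral>\<omega>. indicator (D (Suc n)) \<omega> * V (Suc n) \<omega> \<partial>M)
        = (\<integral>\<omega>. \<epsilon> * indicator (D n - D (Suc n)) \<omega> + indicator (D (Suc n)) \<omega> * V (Suc n) \<omega> \<partial>M)"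
      by (subst Bochner_Integration.integral_add) (auto intro!: int_ind simp: finite_measure.emeasure_finite less_top[symmetric])
    also have "\<dots> \<le> (\<integral>\<omega>. indicator (D n) \<omega> * V (Suc n) \<omega> \<partial>M)"
      using nonneg int step.hyps
      by (intro integral_mono Bochner_Integration.integrable_add int_ind int_const)
        (auto split: split_indicator intro: exit dest: D_anti)
    also have "\<dots> \<le> (\<integral>\<omega>. indicator (D n) \<omega> * V n \<omega> \<partial>M)"
      using super step.hyps D_F by blast
    finally show ?case using step.IH p by (simp add: algebra_simps)
  qed
  have "prob (space M - D n) \<le> (\<integral>\<omega>. V k \<omega> \<partial>M) / \<epsilon>" for n
  proof (cases "n \<ge> k")
    case True
    have "0 \<le> (\<integral>\<omega>. indicator (D n) \<omega> * V n \<omega> \<partial>M)"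
      using nonneg by (intro integral_nonneg_AE AE_I2) auto
    with ineq[OF True] \<open>\<epsilon> > 0\<close> show ?thesis by (simp add: field_simps)
  next
    case False
    then have "space M - D n = {}" by (auto simp: D_def)
    moreover have "(\<integral>\<omega>. V k \<omega> \<partial>M) \<ge> 0" using nonneg by simp
    ultimately show ?thesis using \<open>\<epsilon> > 0\<close> by (metis divide_nonneg_pos measure_empty)
  qed
  moreover have "(\<lambda>n. prob (space M - D n)) \<longlonglongrightarrow> prob (\<Union>n. space M - D n)"
    by (rule finite_Lim_measure_incseq) (auto simp: incseq_def D_def)
  ultimately have "prob (\<Union>n. space M - D n) \<le> (\<integral>\<omega>. V k \<omega> \<partial>M) / \<epsilon>"
    by (intro LIMSEQ_le_const2) auto
  also have "(\<Union>n. space M - D n) = {\<omega> \<in> space M. \<exists>n\<ge>k. V n \<omega> \<ge> \<epsilon>}"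
    by (auto simp: D_def not_less) (meson atLeastAtMost_iff not_le order_refl)
  finally show ?thesis .
qed

text \<open>The maximal inequality started at \<open>j\<close> bounds the probability that
  \<open>V n \<ge> \<epsilon>\<close> infinitely often by the mean of \<open>V j\<close> divided by
  \<open>\<epsilon>\<close>, and this tends to \<open>0\<close> as \<open>j\<close> grows.\<close>

lemma supermartingale_AE_tendsto_0:
  fixes V :: "nat \<Rightarrow> 'a \<Rightarrow> real"
  assumes sub: "\<And>n. subalgebra M (F n)" and mono: "\<And>n. subalgebra (F (Suc n)) (F n)"
    and meas: "\<And>n. V n \<in> borel_measurable (F n)"
    and int: "\<And>n. integrable M (V n)" and nonneg: "\<And>n \<omega>. V n \<omega> \<ge> 0"
    and super: "\<And>n D. k \<le> n \<Longrightarrow> D \<in> sets (F n) \<Longrightarrow>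
      (\<integral>\<omega>. indicator D \<omega> * V (Suc n) \<omega> \<partial>M) \<le> (\<integral>\<omega>. indicator D \<omega> * V n \<omega> \<partial>M)"
    and lim: "(\<lambda>n. \<integral>\<omega>. V n \<omega> \<partial>M) \<longlonglongrightarrow> 0"
  shows "AE \<omega> in M. (\<lambda>n. V n \<omega>) \<longlonglongrightarrow> 0"
proof -
  have [measurable]: "V n \<in> borel_measurable M" for n
    using int by auto
  have ev: "AE \<omega> in M. eventually (\<lambda>n. V n \<omega> < \<epsilon>) sequentially" if "\<epsilon> > 0" for \<epsilon> :: real
  proof -
    define E where "E = {\<omega> \<in> space M. \<forall>j. \<exists>n\<ge>j. V n \<omega> \<ge> \<epsilon>}"
    have E [measurable]: "E \<in> events" unfolding E_def by measurable
    have "prob E \<le> (\<integral>\<omega>. V j \<omega> \<partial>M) / \<epsilon>" if "j \<ge> k" for j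
    proof -
      have "prob E \<le> prob {\<omega> \<in> space M. \<exists>n\<ge>j. V n \<omega> \<ge> \<epsilon>}"
        by (rule finite_measure_mono) (auto simp: E_def)
      also have "\<dots> \<le> (\<integral>\<omega>. V j \<omega> \<partial>M) / \<epsilon>"
        using sub mono meas int nonneg super \<open>\<epsilon> > 0\<close> that
        by (intro supermartingale_maximal[where F = F]) auto
      finally show ?thesis .
    qed
    moreover have "(\<lambda>j. (\<integral>\<omega>. V j \<omega> \<partial>M) / \<epsilon>) \<longlonglongrightarrow> 0 / \<epsilon>"
      by (intro tendsto_divide lim tendsto_const) (use that in auto)
    ultimately have "prob E \<le> 0"
      by (intro LIMSEQ_le_const[where X = "\<lambda>j. (\<integral>\<omega>. V j \<omega> \<partial>M) / \<epsilon>"]) auto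
    then have "prob E = 0" by (simp add: measure_le_0_iff)
    then have "AE \<omega> in M. \<omega> \<notin> E" using E prob_eq_0 by blast
    then show ?thesis
      by (rule AE_mp) (intro AE_I2, auto simp: E_def eventually_sequentially not_less[symmetric] simp del: not_less)
  qed
  \<comment> \<open>Countably many thresholds suffice, so a single null set serves all of
    them.\<close>
  have "AE \<omega> in M. \<forall>i. eventually (\<lambda>n. V n \<omega> < inverse (real (Suc i))) sequentially"
    unfolding AE_all_countable by (intro allI ev) simp
  then show ?thesis
  proof (rule AE_mp, intro AE_I2 impI)
    fix \<omega> assume *: "\<forall>i. eventually (\<lambda>n. V n \<omega> < inverse (real (Suc i))) sequentially"
    show "(\<lambda>n. V n \<omega>) \<longlonglongrightarrow> 0"
    proof (rule tendstoI)
      fix r :: real assume "r > 0"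
      then obtain i where "inverse (real (Suc i)) < r" using reals_Archimedean by blast
      with * have "eventually (\<lambda>n. V n \<omega> < inverse (real (Suc i))) sequentially" by blast
      then show "eventually (\<lambda>n. dist (V n \<omega>) 0 < r) sequentially"
        by eventually_elim (use nonneg[of _ \<omega>] \<open>inverse (real (Suc i)) < r\<close> in \<open>auto simp: dist_real_def\<close>)
    qed
  qed
qed

end

section \<open>Measurability of integer-valued variables\<close>

text \<open>Tuples of counts are measurable into a discrete space, so that any function of them,
  \<open>hypergeometric_mass\<close> in particular, is measurable at once.\<close>

lemma measurable_count_space_pairI:
  fixes f :: "'w \<Rightarrow> 'c::countable" and g :: "'w \<Rightarrow> 'd::countable"
  assumes [measurable]: "f \<in> measurable F (count_space UNIV)" "g \<in> measurable F (count_space UNIV)"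
  shows "(\<lambda>\<omega>. (f \<omega>, g \<omega>)) \<in> measurable F (count_space UNIV)"
proof -
  have "(\<lambda>\<omega>. (f \<omega>, g \<omega>)) \<in> measurable F (count_space UNIV \<Otimes>\<^sub>M count_space UNIV)"
    by measurable
  then show ?thesis
    by (simp add: pair_measure_countable)
qed

lemma measurable_count_space_natI:
  fixes f :: "'w \<Rightarrow> nat"
  assumes [measurable]: "(\<lambda>\<omega>. real (f \<omega>)) \<in> borel_measurable F"
  shows "f \<in> measurable F (count_space UNIV)"
proof (rule measurable_count_space_eq2_countable[THEN iffD2], intro conjI ballI)
  fix k :: nat
  have "{\<omega> \<in> space F. real (f \<omega>) = real k} \<in> sets F"
    by measurable
  also have "{\<omega> \<in> space F. real (f \<omega>) = real k} = f -` {k} \<inter> space F"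
    by auto
  finally show "f -` {k} \<inter> space F \<in> sets F" .
qed auto

lemma subalgebra_vimage_algebra:
  assumes "space F = space M" and "f \<in> measurable F L"
  shows "subalgebra F (vimage_algebra (space M) f L)"
  using sets_image_in_sets[OF assms] assms(1) by (simp add: subalgebra_def)

section \<open>Information available during a round\<close>

context urn_model
begin

abbreviation H :: "nat \<Rightarrow> 'w \<Rightarrow> nat" where "H \<equiv> balls_A a X A"
abbreviation K :: "nat \<Rightarrow> 'w \<Rightarrow> nat" where "K \<equiv> balls_B b N X B"
abbreviation S :: "nat \<Rightarrow> 'w \<Rightarrow> nat" where "S \<equiv> balls_total a b N X A B"
abbreviation hist :: "nat \<Rightarrow> 'w \<Rightarrow> nat \<Rightarrow> nat \<times> nat \<times> nat \<times> nat" where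
  "hist \<equiv> history N X A B"

text \<open>The history stops before \<open>n\<close>, so the information after \<open>n\<close>
  draws is \<open>past (Suc n)\<close>, and this is where \<open>H n\<close> and \<open>K n\<close>
  are measurable. The three sigma-algebras \<open>past\<close>, \<open>past_N\<close>,
  \<open>past_NX\<close> follow the order of a round: sample size, then sample; the reinforcement is
  independent of the last one.\<close>

definition past :: "nat \<Rightarrow> 'w measure" where
  "past n = vimage_algebra (space M) (hist n) (history_space n)"

definition past_N :: "nat \<Rightarrow> 'w measure" where
  "past_N n = vimage_algebra (space M) (\<lambda>\<omega>. (hist n \<omega>, N n \<omega>)) (history_space n \<Otimes>\<^sub>M count_space UNIV)"

definition past_NX :: "nat \<Rightarrow> 'w measure" where
  "past_NX n = vimage_algebra (space M) (\<lambda>\<omega>. (hist n \<omega>, N n \<omega>, X n \<omega>))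
    (history_space n \<Otimes>\<^sub>M count_space UNIV \<Otimes>\<^sub>M count_space UNIV)"

lemma hist_in_space: "hist n \<omega> \<in> space (history_space n)"
  by (auto simp: history_def history_space_def space_PiM)

lemma space_past [simp]: "space (past n) = space M" "space (past_N n) = space M" "space (past_NX n) = space M"
  by (simp_all add: past_def past_N_def past_NX_def)

lemma hist_measurableI:
  assumes "\<And>j. 1 \<le> j \<Longrightarrow> j < n \<Longrightarrow> N j \<in> measurable F (count_space UNIV)"
    and "\<And>j. 1 \<le> j \<Longrightarrow> j < n \<Longrightarrow> X j \<in> measurable F (count_space UNIV)"
    and "\<And>j. 1 \<le> j \<Longrightarrow> j < n \<Longrightarrow> A j \<in> measurable F (count_space UNIV)"
    and "\<And>j. 1 \<le> j \<Longrightarrow> j < n \<Longrightarrow> B j \<in> measurable F (count_space UNIV)"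
  shows "hist n \<in> measurable F (history_space n)"
  unfolding history_def[abs_def] history_space_def
  using assms by (intro measurable_restrict measurable_count_space_pairI) auto

lemma hist_measurable_past: "hist n \<in> measurable (past n) (history_space n)"
  unfolding past_def by (rule measurable_vimage_algebra1) (auto simp: hist_in_space)

lemma hist_N_measurable_past_N:
  "(\<lambda>\<omega>. (hist n \<omega>, N n \<omega>)) \<in> measurable (past_N n) (history_space n \<Otimes>\<^sub>M count_space UNIV)"
  unfolding past_N_def by (rule measurable_vimage_algebra1) (auto simp: hist_in_space space_pair_measure)

lemma hist_NX_measurable_past_NX:
  "(\<lambda>\<omega>. (hist n \<omega>, N n \<omega>, X n \<omega>))
    \<in> measurable (past_NX n) (history_space n \<Otimes>\<^sub>M count_space UNIV \<Otimes>\<^sub>M count_space UNIV)"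
  unfolding past_NX_def by (rule measurable_vimage_algebra1) (auto simp: hist_in_space space_pair_measure)

lemma hist_measurable_past_N: "hist n \<in> measurable (past_N n) (history_space n)"
  using measurable_compose[OF hist_N_measurable_past_N measurable_fst] by simp

lemma hist_measurable_past_NX: "hist n \<in> measurable (past_NX n) (history_space n)"
  using measurable_compose[OF hist_NX_measurable_past_NX measurable_fst] by simp

lemma N_measurable_past_N: "N n \<in> measurable (past_N n) (count_space UNIV)"
  using measurable_compose[OF hist_N_measurable_past_N measurable_snd] by simp

lemma N_measurable_past_NX: "N n \<in> measurable (past_NX n) (count_space UNIV)"
  using measurable_compose[OF measurable_compose[OF hist_NX_measurable_past_NX measurable_snd] measurable_fst]
  by simp

lemma X_measurable_past_NX: "X n \<in> measurable (past_NX n) (count_space UNIV)"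
  using measurable_compose[OF measurable_compose[OF hist_NX_measurable_past_NX measurable_snd] measurable_snd]
  by simp

lemma hist_component_measurable:
  assumes "hist n \<in> measurable F (history_space n)" "1 \<le> j" "j < n"
  shows "N j \<in> measurable F (count_space UNIV)" "X j \<in> measurable F (count_space UNIV)"
    "A j \<in> measurable F (count_space UNIV)" "B j \<in> measurable F (count_space UNIV)"
proof -
  have "(\<lambda>\<omega>. hist n \<omega> j) \<in> measurable F (count_space UNIV)"
    by (rule measurable_compose[OF assms(1)[unfolded history_space_def] measurable_component_singleton[of j]])
      (use assms in simp)
  then have *: "(\<lambda>\<omega>. f (hist n \<omega> j)) \<in> measurable F (count_space UNIV)"
    for f :: "_ \<Rightarrow> nat" by (rule measurable_compose) simp
  have "hist n \<omega> j = (N j \<omega>, X j \<omega>, A j \<omega>, B j \<omega>)" for \<omega>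
    using assms by (simp add: history_def)
  then show "N j \<in> measurable F (count_space UNIV)" "X j \<in> measurable F (count_space UNIV)"
    "A j \<in> measurable F (count_space UNIV)" "B j \<in> measurable F (count_space UNIV)"
    using *[of fst] *[of "fst \<circ> snd"] *[of "fst \<circ> snd \<circ> snd"] *[of "snd \<circ> snd \<circ> snd"]
    by simp_all
qed

text \<open>\<open>F\<close> is left open because the same fact serves \<open>M\<close> and all
  three levels of information.\<close>

lemma balls_measurable:
  assumes "hist m \<in> measurable F (history_space m)" and "n < m"
  shows "H n \<in> measurable F (count_space UNIV)" "K n \<in> measurable F (count_space UNIV)"
    "S n \<in> measurable F (count_space UNIV)"
proof -
  have [measurable]: "N j \<in> measurable F (count_space UNIV)" "X j \<in> measurable F (count_space UNIV)"
    "A j \<in> measurable F (count_space UNIV)" "B j \<in> measurable F (count_space UNIV)" if "j \<in> {1..n}" for j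
    using hist_component_measurable[OF assms(1), of j] that assms(2) by auto
  have H: "(\<lambda>\<omega>. real (H n \<omega>)) \<in> borel_measurable F"
    unfolding balls_A_def by simp measurable
  have K: "(\<lambda>\<omega>. real (K n \<omega>)) \<in> borel_measurable F"
    unfolding balls_B_def by simp measurable
  have S: "(\<lambda>\<omega>. real (S n \<omega>)) \<in> borel_measurable F"
    using H K unfolding balls_total_def by simp
  show "H n \<in> measurable F (count_space UNIV)" "K n \<in> measurable F (count_space UNIV)"
    "S n \<in> measurable F (count_space UNIV)"
    using H K S by (auto intro: measurable_count_space_natI)
qed

lemma subalgebra_past: "subalgebra M (past n)"
  unfolding past_def
  by (intro subalgebra_vimage_algebra hist_measurableI measurable_N measurable_X measurable_A measurable_B) auto

lemma hist_measurable: "hist n \<in> measurable M (history_space n)"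
  by (intro hist_measurableI measurable_N measurable_X measurable_A measurable_B)

lemma subalgebra_past_N: "n \<ge> 1 \<Longrightarrow> subalgebra M (past_N n)"
  unfolding past_N_def
  by (intro subalgebra_vimage_algebra measurable_Pair hist_measurable measurable_N) auto

lemma subalgebra_past_NX: "n \<ge> 1 \<Longrightarrow> subalgebra M (past_NX n)"
  unfolding past_NX_def
  by (intro subalgebra_vimage_algebra measurable_Pair hist_measurable measurable_N measurable_X) auto

lemma subalgebra_past_N_past: "subalgebra (past_N n) (past n)"
  unfolding past_def by (rule subalgebra_vimage_algebra) (auto simp: hist_measurable_past_N)

lemma subalgebra_past_NX_past_N: "subalgebra (past_NX n) (past_N n)"
  unfolding past_N_def
  by (rule subalgebra_vimage_algebra)
    (auto intro!: measurable_Pair simp: hist_measurable_past_NX N_measurable_past_NX)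

lemma subalgebra_past_Suc: "subalgebra (past (Suc n)) (past n)"
proof -
  have "hist n \<in> measurable (past (Suc n)) (history_space n)"
    by (intro hist_measurableI hist_component_measurable[OF hist_measurable_past]) auto
  then show ?thesis
    unfolding past_def[of n] by (intro subalgebra_vimage_algebra) auto
qed

lemma H_pos: "H n \<omega> \<ge> 1" and K_pos: "K n \<omega> \<ge> 1"
  using a_ge_1 b_ge_1 by (auto simp: balls_A_def balls_B_def)

lemma S_eq: "S n \<omega> = H n \<omega> + K n \<omega>"
  by (simp add: balls_total_def)

lemma H_Suc: "H (Suc n) \<omega> = H n \<omega> + A (Suc n) \<omega> * X (Suc n) \<omega>"
  by (simp add: balls_A_def)

lemma K_Suc: "K (Suc n) \<omega> = K n \<omega> + B (Suc n) \<omega> * (N (Suc n) \<omega> - X (Suc n) \<omega>)"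
  by (simp add: balls_B_def)

lemma H_mono: "m \<le> n \<Longrightarrow> H m \<omega> \<le> H n \<omega>"
  by (rule lift_Suc_mono_le) (auto simp: H_Suc)

end

section \<open>Integrated forms of the assumptions on the draw, and almost sure bounds\<close>

locale bounded_urn = urn_model +
  fixes C :: nat
  assumes bounds: "n \<ge> 1 \<Longrightarrow> AE \<omega> in M. A n \<omega> \<le> C \<and> B n \<omega> \<le> C \<and> N n \<omega> \<le> C"
begin

text \<open>This is (A2) tested against a bounded function of the past and the sample size.
  Integrability of the right-hand side is inherited from the conditional expectation, without a
  bound on \<open>hypergeometric_mass\<close>.\<close>

lemma integral_mult_indicator_X:
  assumes \<phi>: "\<phi> \<in> borel_measurable (past_N (Suc n))" and bd: "AE \<omega> in M. \<bar>\<phi> \<omega>\<bar> \<le> c"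
  shows "(\<integral>\<omega>. \<phi> \<omega> * indicator {\<omega> \<in> space M. X (Suc n) \<omega> = k} \<omega> \<partial>M)
    = (\<integral>\<omega>. \<phi> \<omega> * hypergeometric_mass (N (Suc n) \<omega>) (S n \<omega>) (H n \<omega>) k \<partial>M)"
    and "integrable M (\<lambda>\<omega>. \<phi> \<omega> * hypergeometric_mass (N (Suc n) \<omega>) (S n \<omega>) (H n \<omega>) k)"
proof -
  interpret G: finite_measure_subalgebra M "past_N (Suc n)"
    by unfold_locales (rule subalgebra_past_N, simp)
  have [measurable]: "\<phi> \<in> borel_measurable M"
    using measurable_from_subalg[OF G.subalg \<phi>] .
  have X [measurable]: "X (Suc n) \<in> measurable M (count_space UNIV)"
    by (rule measurable_X) simp
  note [measurable] = balls_measurable[OF hist_measurable lessI] measurable_N[of "Suc n", simplified]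
  let ?g = "indicator {\<omega> \<in> space M. X (Suc n) \<omega> = k} :: 'a \<Rightarrow> real"
  let ?h = "\<lambda>\<omega>. hypergeometric_mass (N (Suc n) \<omega>) (S n \<omega>) (H n \<omega>) k"
  have int: "integrable M (\<lambda>\<omega>. \<phi> \<omega> * ?g \<omega>)"
  proof (rule integrable_const_bound[where B = c])
    show "AE \<omega> in M. norm (\<phi> \<omega> * ?g \<omega>) \<le> c"
      using bd by eventually_elim (auto split: split_indicator)
  qed measurable
  have "(\<lambda>\<omega>. (N (Suc n) \<omega>, S n \<omega>, H n \<omega>)) \<in> measurable M (count_space UNIV)"
    by (intro measurable_count_space_pairI) measurable
  then have "(\<lambda>\<omega>. (\<lambda>(x, y, z). hypergeometric_mass x y z k) (N (Suc n) \<omega>, S n \<omega>, H n \<omega>)) \<in> borel_measurable M"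
    by (rule measurable_compose) simp
  then have h [measurable]: "?h \<in> borel_measurable M" by simp
  have ae: "AE \<omega> in M. real_cond_exp M (past_N (Suc n)) ?g \<omega> = ?h \<omega>"
    using sample_hypergeometric[of "Suc n" k] by (simp add: cond_mass_def past_N_def)
  have ae': "AE \<omega> in M. \<phi> \<omega> * real_cond_exp M (past_N (Suc n)) ?g \<omega> = \<phi> \<omega> * ?h \<omega>"
    using ae by eventually_elim simp
  have m: "?g \<in> borel_measurable M" by measurable
  note ce = G.real_cond_exp_intg[OF int \<phi> m]
  show "(\<integral>\<omega>. \<phi> \<omega> * ?g \<omega> \<partial>M) = (\<integral>\<omega>. \<phi> \<omega> * ?h \<omega> \<partial>M)"
    unfolding ce(2)[symmetric] by (rule integral_cong_AE[OF _ _ ae']) measurable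
  show "integrable M (\<lambda>\<omega>. \<phi> \<omega> * ?h \<omega>)"
    by (rule integrable_cong_AE_imp[OF ce(1) _ ae']) measurable
qed

text \<open>The guard in \<open>hypergeometric_mass\<close> gives mass \<open>0\<close> to every
  \<open>k\<close> beyond the sample size. Testing (A2) on the event \<open>N n < k\<close> makes
  each event \<open>X n = k > N n\<close> null, and there are countably many \<open>k\<close>. From
  here on the truncated subtraction \<open>N - X\<close> agrees almost surely with the true
  one.\<close>

lemma AE_X_le_N: "n \<ge> 1 \<Longrightarrow> AE \<omega> in M. X n \<omega> \<le> N n \<omega>"
proof -
  assume "n \<ge> 1"
  then obtain m where n: "n = Suc m" by (cases n) auto
  have "AE \<omega> in M. \<not> (X n \<omega> = k \<and> N n \<omega> < k)" for k
  proof -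
    let ?D = "{\<omega> \<in> space M. N n \<omega> < k}"
    let ?E = "{\<omega> \<in> space M. X n \<omega> = k \<and> N n \<omega> < k}"
    note [measurable] = measurable_N[OF \<open>n \<ge> 1\<close>] measurable_X[OF \<open>n \<ge> 1\<close>]
    have "{\<omega> \<in> space (past_N n). N n \<omega> < k} \<in> sets (past_N n)"
      using N_measurable_past_N by measurable
    then have D: "?D \<in> sets (past_N n)" by simp
    have "prob ?E = (\<integral>\<omega>. indicator ?E \<omega> \<partial>M)"
      by (simp add: measure_def[symmetric])
    also have "\<dots> = (\<integral>\<omega>. indicator ?D \<omega> * indicator {\<omega> \<in> space M. X n \<omega> = k} \<omega> \<partial>M)"
      by (intro Bochner_Integration.integral_cong) (auto split: split_indicator)
    also have "\<dots> = (\<integral>\<omega>. indicator ?D \<omega> * hypergeometric_mass (N n \<omega>) (S m \<omega>) (H m \<omega>) k \<partial>M)"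
      unfolding n using D by (intro integral_mult_indicator_X[where c = 1]) (auto simp: n)
    also have "\<dots> = (\<integral>\<omega>. 0 \<partial>M)"
      by (intro Bochner_Integration.integral_cong)
        (auto split: split_indicator simp: hypergeometric_mass_def)
    finally have "prob ?E = 0" by simp
    then have "AE \<omega> in M. \<omega> \<notin> ?E" by (subst (asm) prob_eq_0) auto
    then show ?thesis by (rule AE_mp) (auto intro!: AE_I2)
  qed
  then have "AE \<omega> in M. \<forall>k. \<not> (X n \<omega> = k \<and> N n \<omega> < k)"
    unfolding AE_all_countable by blast
  then show ?thesis by eventually_elim (auto simp: not_less)
qed

lemma balls_bound:
  assumes "\<forall>j\<ge>1. A j \<omega> \<le> C \<and> B j \<omega> \<le> C \<and> N j \<omega> \<le> C \<and> X j \<omega> \<le> N j \<omega>"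
  shows "S n \<omega> \<le> a + b + C * C * n"
proof (induction n)
  case 0
  show ?case by (simp add: balls_total_def balls_A_def balls_B_def)
next
  case (Suc n)
  have b: "A (Suc n) \<omega> \<le> C" "B (Suc n) \<omega> \<le> C" "N (Suc n) \<omega> \<le> C" "X (Suc n) \<omega> \<le> N (Suc n) \<omega>"
    using assms by auto
  have "A (Suc n) \<omega> * X (Suc n) \<omega> + B (Suc n) \<omega> * (N (Suc n) \<omega> - X (Suc n) \<omega>)
      \<le> C * X (Suc n) \<omega> + C * (N (Suc n) \<omega> - X (Suc n) \<omega>)"
    using b by (intro add_mono mult_right_mono) auto
  also have "\<dots> = C * N (Suc n) \<omega>" using b by (simp flip: distrib_left)
  also have "\<dots> \<le> C * C" using b by simp
  finally show ?case using Suc.IH by (simp add: S_eq H_Suc K_Suc)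
qed

lemma AE_bounds: "AE \<omega> in M. \<forall>n\<ge>1. A n \<omega> \<le> C \<and> B n \<omega> \<le> C \<and> N n \<omega> \<le> C \<and> X n \<omega> \<le> N n \<omega>"
proof -
  have "AE \<omega> in M. n \<ge> 1 \<longrightarrow> A n \<omega> \<le> C \<and> B n \<omega> \<le> C \<and> N n \<omega> \<le> C \<and> X n \<omega> \<le> N n \<omega>" for n
  proof (cases "n \<ge> 1")
    case True
    show ?thesis using bounds[OF True] AE_X_le_N[OF True] by eventually_elim auto
  qed simp
  then show ?thesis by (simp add: AE_all_countable)
qed

text \<open>The sum in (A1) has a random upper limit. Since \<open>S n\<close> is almost surely at
  most a constant \<open>c\<close> and \<open>m \<le> S n\<close> is an event of the past,
  indicators turn it into a sum over \<open>1..c\<close> that can be integrated term by term. The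
  result is that \<open>1 \<le> N (Suc n) \<le> S n\<close> has probability at least
  \<open>1\<close>.\<close>

lemma AE_sample_size: "AE \<omega> in M. 1 \<le> N (Suc n) \<omega> \<and> N (Suc n) \<omega> \<le> S n \<omega>"
proof -
  interpret G: finite_measure_subalgebra M "past (Suc n)"
    by unfold_locales (rule subalgebra_past)
  define c where "c = a + b + C * C * n"
  let ?I = "\<lambda>m. indicator {\<omega> \<in> space M. m \<le> S n \<omega>} :: 'a \<Rightarrow> real"
  let ?g = "\<lambda>m. indicator {\<omega> \<in> space M. N (Suc n) \<omega> = m} :: 'a \<Rightarrow> real"
  let ?E = "{\<omega> \<in> space M. 1 \<le> N (Suc n) \<omega> \<and> N (Suc n) \<omega> \<le> S n \<omega>}"
  note [measurable] = balls_measurable[OF hist_measurable lessI] measurable_N[of "Suc n", simplified]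
  have "(\<lambda>\<omega>. (N (Suc n) \<omega>, S n \<omega>)) \<in> measurable M (count_space UNIV)"
    by (intro measurable_count_space_pairI) measurable
  from measurable_sets[OF this, of "{(x, y). 1 \<le> x \<and> x \<le> y}"]
  have E: "?E \<in> events" by (simp add: vimage_def Int_def conj_commute)
  have Sc: "AE \<omega> in M. S n \<omega> \<le> c"
    using AE_bounds by eventually_elim (auto simp: c_def intro: balls_bound)
  have I: "?I m \<in> borel_measurable (past (Suc n))" for m
  proof -
    have [measurable]: "S n \<in> measurable (past (Suc n)) (count_space UNIV)"
      by (rule balls_measurable[OF hist_measurable_past lessI])
    have "{\<omega> \<in> space (past (Suc n)). m \<le> S n \<omega>} \<in> sets (past (Suc n))" by measurable
    then show ?thesis by simp
  qed
  have int: "integrable M (\<lambda>\<omega>. ?I m \<omega> * ?g m \<omega>)" for m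
    by (rule integrable_const_bound[where B = 1]) (auto split: split_indicator)
  have m: "?g m \<in> borel_measurable M" for m by measurable
  note ce = G.real_cond_exp_intg[OF int I m]
  have "AE \<omega> in M. (\<Sum>m = 1..S n \<omega>. real_cond_exp M (past (Suc n)) (?g m) \<omega>) = 1"
    using sample_size[of "Suc n"] by (simp add: cond_mass_def past_def)
  then have ae: "AE \<omega> in M. (\<Sum>m = 1..c. ?I m \<omega> * real_cond_exp M (past (Suc n)) (?g m) \<omega>) = 1"
    using Sc AE_space
  proof eventually_elim
    case (elim \<omega>)
    have "(\<Sum>m = 1..c. ?I m \<omega> * real_cond_exp M (past (Suc n)) (?g m) \<omega>)
        = (\<Sum>m = 1..S n \<omega>. real_cond_exp M (past (Suc n)) (?g m) \<omega>)"
      using elim by (intro sum.mono_neutral_cong_right) (auto split: split_indicator)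
    then show ?case using elim by simp
  qed
  have "1 = (\<integral>\<omega>. (\<Sum>m = 1..c. ?I m \<omega> * real_cond_exp M (past (Suc n)) (?g m) \<omega>) \<partial>M)"
    by (subst integral_cong_AE[OF _ _ ae]) (auto simp: prob_space)
  also have "\<dots> = (\<Sum>m = 1..c. \<integral>\<omega>. ?I m \<omega> * real_cond_exp M (past (Suc n)) (?g m) \<omega> \<partial>M)"
    by (rule Bochner_Integration.integral_sum) (rule ce(1))
  also have "\<dots> = (\<Sum>m = 1..c. \<integral>\<omega>. ?I m \<omega> * ?g m \<omega> \<partial>M)"
    by (simp only: ce(2))
  also have "\<dots> = (\<integral>\<omega>. (\<Sum>m = 1..c. ?I m \<omega> * ?g m \<omega>) \<partial>M)"
    by (rule Bochner_Integration.integral_sum[symmetric]) (rule int)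
  also have "\<dots> \<le> (\<integral>\<omega>. indicator ?E \<omega> \<partial>M)"
  proof (rule integral_mono)
    show "integrable M (\<lambda>\<omega>. \<Sum>m = 1..c. ?I m \<omega> * ?g m \<omega>)"
      by (rule Bochner_Integration.integrable_sum) (rule int)
    show "integrable M (indicator ?E :: 'a \<Rightarrow> real)"
      using E by (auto simp: less_top[symmetric])
    fix \<omega> assume "\<omega> \<in> space M"
    have "(\<Sum>m = 1..c. ?I m \<omega> * ?g m \<omega>) = (\<Sum>m = 1..c. if m = N (Suc n) \<omega> then ?I m \<omega> else 0)"
      using \<open>\<omega> \<in> space M\<close> by (intro sum.cong) (auto split: split_indicator)
    also have "\<dots> \<le> indicator ?E \<omega>"
      using \<open>\<omega> \<in> space M\<close> by (auto split: split_indicator)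
    finally show "(\<Sum>m = 1..c. ?I m \<omega> * ?g m \<omega>) \<le> indicator ?E \<omega>" .
  qed
  also have "\<dots> = prob ?E" by (auto intro!: arg_cong[where f = prob])
  finally have "prob ?E = 1" using prob_le_1[of ?E] by linarith
  then have "AE \<omega> in M. \<omega> \<in> ?E" using prob_eq_1[OF E] by blast
  then show ?thesis by eventually_elim simp
qed

text \<open>Chosen so that \<open>a + b + C * C * n \<le> L * Suc n\<close>; the reciprocal of
  \<open>S n\<close> is then at least a multiple of a harmonic term, already from
  \<open>n = 0\<close>.\<close>

abbreviation L :: nat where "L \<equiv> a + b + C * C"

lemma AE_step:
  "AE \<omega> in M. 1 \<le> A (Suc n) \<omega> \<and> A (Suc n) \<omega> \<le> C \<and> B (Suc n) \<omega> \<le> C \<and>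
    1 \<le> N (Suc n) \<omega> \<and> N (Suc n) \<omega> \<le> C \<and> N (Suc n) \<omega> \<le> S n \<omega> \<and> X (Suc n) \<omega> \<le> N (Suc n) \<omega> \<and>
    S n \<omega> \<le> L * Suc n"
  using AE_bounds AE_sample_size[of n] AE_space
proof eventually_elim
  case (elim \<omega>)
  have "S n \<omega> \<le> a + b + C * C * n"
    using elim(1) by (rule balls_bound)
  also have "\<dots> \<le> L * Suc n" by (simp add: algebra_simps)
  finally show ?case using elim reinforcement_pos[of "Suc n" \<omega>] by auto
qed

lemma C_pos: "C \<ge> 1"
proof -
  have "AE \<omega> in M. C \<ge> 1"
    using AE_step[of 0] by eventually_elim auto
  then show ?thesis by simp
qed

text \<open>Because \<open>X\<close> is almost surely at most \<open>C\<close>, it is a finite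
  combination of the indicators of \<open>X = k\<close>, so the masses in (A2) determine its
  mean.\<close>

lemma integral_mult_X:
  assumes \<phi>: "\<phi> \<in> borel_measurable (past_N (Suc n))" and bd: "AE \<omega> in M. \<bar>\<phi> \<omega>\<bar> \<le> c"
  shows "(\<integral>\<omega>. \<phi> \<omega> * real (X (Suc n) \<omega>) \<partial>M)
    = (\<integral>\<omega>. \<phi> \<omega> * (real (N (Suc n) \<omega>) * real (H n \<omega>) / real (S n \<omega>)) \<partial>M)"
proof -
  let ?g = "\<lambda>k. indicator {\<omega> \<in> space M. X (Suc n) \<omega> = k} :: 'a \<Rightarrow> real"
  let ?h = "\<lambda>k \<omega>. hypergeometric_mass (N (Suc n) \<omega>) (S n \<omega>) (H n \<omega>) k"
  have [measurable]: "\<phi> \<in> borel_measurable M"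
    using measurable_from_subalg[OF subalgebra_past_N \<phi>] by simp
  note [measurable] = balls_measurable[OF hist_measurable lessI]
    measurable_N[of "Suc n", simplified] measurable_X[of "Suc n", simplified]
  note h = integral_mult_indicator_X[OF \<phi> bd]
  have [measurable]: "(\<lambda>\<omega>. \<phi> \<omega> * ?h k \<omega>) \<in> borel_measurable M" for k
    using h(2) by auto
  have int: "integrable M (\<lambda>\<omega>. \<phi> \<omega> * ?g k \<omega>)" for k
  proof (rule integrable_const_bound[where B = c])
    show "AE \<omega> in M. norm (\<phi> \<omega> * ?g k \<omega>) \<le> c"
      using bd by eventually_elim (auto split: split_indicator)
  qed measurable
  have "(\<integral>\<omega>. \<phi> \<omega> * real (X (Suc n) \<omega>) \<partial>M) = (\<integral>\<omega>. (\<Sum>k\<le>C. real k * (\<phi> \<omega> * ?g k \<omega>)) \<partial>M)"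
  proof (rule integral_cong_AE)
    show "AE \<omega> in M. \<phi> \<omega> * real (X (Suc n) \<omega>) = (\<Sum>k\<le>C. real k * (\<phi> \<omega> * ?g k \<omega>))"
      using AE_step[of n] AE_space
    proof eventually_elim
      case (elim \<omega>)
      have "(\<Sum>k\<le>C. real k * (\<phi> \<omega> * ?g k \<omega>)) = (\<Sum>k\<le>C. if k = X (Suc n) \<omega> then real k * \<phi> \<omega> else 0)"
        using elim by (intro sum.cong) (auto split: split_indicator)
      also have "\<dots> = \<phi> \<omega> * real (X (Suc n) \<omega>)" using elim by simp
      finally show ?case by simp
    qed
  qed measurable
  also have "\<dots> = (\<Sum>k\<le>C. \<integral>\<omega>. real k * (\<phi> \<omega> * ?g k \<omega>) \<partial>M)"
    by (rule Bochner_Integration.integral_sum) (intro integrable_mult_right int)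
  also have "\<dots> = (\<Sum>k\<le>C. \<integral>\<omega>. real k * (\<phi> \<omega> * ?h k \<omega>) \<partial>M)"
    by (simp only: integral_mult_right_zero h(1))
  also have "\<dots> = (\<integral>\<omega>. (\<Sum>k\<le>C. real k * (\<phi> \<omega> * ?h k \<omega>)) \<partial>M)"
    by (rule Bochner_Integration.integral_sum[symmetric]) (intro integrable_mult_right h(2))
  also have "\<dots> = (\<integral>\<omega>. \<phi> \<omega> * (real (N (Suc n) \<omega>) * real (H n \<omega>) / real (S n \<omega>)) \<partial>M)"
  proof (rule integral_cong_AE)
    show "AE \<omega> in M. (\<Sum>k\<le>C. real k * (\<phi> \<omega> * ?h k \<omega>))
        = \<phi> \<omega> * (real (N (Suc n) \<omega>) * real (H n \<omega>) / real (S n \<omega>))"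
      using AE_step[of n]
    proof eventually_elim
      case (elim \<omega>)
      have "(\<Sum>k\<le>C. real k * (\<phi> \<omega> * ?h k \<omega>)) = \<phi> \<omega> * (\<Sum>k\<le>C. real k * ?h k \<omega>)"
        by (simp add: sum_distrib_left algebra_simps)
      \<comment> \<open>The range can shrink from \<open>C\<close> to the sample size because the
        guard makes the masses in between vanish.\<close>
      also have "(\<Sum>k\<le>C. real k * ?h k \<omega>) = (\<Sum>k\<le>N (Suc n) \<omega>. real k * ?h k \<omega>)"
        using elim by (intro sum.mono_neutral_right) (auto simp: hypergeometric_mass_def)
      also have "\<dots> = real (N (Suc n) \<omega>) * real (H n \<omega>) / real (S n \<omega>)"
        using elim by (simp only: S_eq hypergeometric_mean)
      finally show ?case .
    qed
  qed measurable
  finally show ?thesis .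
qed

text \<open>The test function may depend on the current sample, since the reinforcement is
  independent of \<open>past_NX\<close> and not merely of the earlier rounds.\<close>

lemma integral_mult_reinforcement:
  assumes \<psi>: "\<psi> \<in> borel_measurable (past_NX (Suc n))" and bd: "AE \<omega> in M. \<bar>\<psi> \<omega>\<bar> \<le> c"
  shows "(\<integral>\<omega>. \<psi> \<omega> * real (A (Suc n) \<omega>) \<partial>M) = (\<integral>\<omega>. real (A (Suc n) \<omega>) \<partial>M) * (\<integral>\<omega>. \<psi> \<omega> \<partial>M)"
    and "(\<integral>\<omega>. \<psi> \<omega> * real (B (Suc n) \<omega>) \<partial>M) = (\<integral>\<omega>. real (B (Suc n) \<omega>) \<partial>M) * (\<integral>\<omega>. \<psi> \<omega> \<partial>M)"
proof -
  have [measurable]: "\<psi> \<in> borel_measurable M"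
    using measurable_from_subalg[OF subalgebra_past_NX \<psi>] by simp
  note [measurable] = measurable_A[of "Suc n", simplified] measurable_B[of "Suc n", simplified]
  define AB where "AB = vimage_algebra (space M) (\<lambda>\<omega>. (A (Suc n) \<omega>, B (Suc n) \<omega>)) (count_space UNIV)"
  have ind: "indep_set (sets AB) (sets (past_NX (Suc n)))"
    using reinforcement_indep[of "Suc n"] by (simp add: AB_def past_NX_def)
  have ABm: "(\<lambda>\<omega>. (A (Suc n) \<omega>, B (Suc n) \<omega>)) \<in> measurable AB (count_space UNIV)"
    unfolding AB_def by (rule measurable_vimage_algebra1) auto
  have int: "integrable M \<psi>"
    by (rule integrable_const_bound[where B = c]) (use bd in auto)
  \<comment> \<open>The independence assumption concerns the pair, so both coordinates are treated
    at once as functions of it.\<close>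
  have *: "(\<integral>\<omega>. \<psi> \<omega> * f (A (Suc n) \<omega>, B (Suc n) \<omega>) \<partial>M)
      = (\<integral>\<omega>. f (A (Suc n) \<omega>, B (Suc n) \<omega>) \<partial>M) * (\<integral>\<omega>. \<psi> \<omega> \<partial>M)"
    if f: "AE \<omega> in M. \<bar>f (A (Suc n) \<omega>, B (Suc n) \<omega>)\<bar> \<le> real C" for f :: "nat \<times> nat \<Rightarrow> real"
  proof -
    let ?Y = "\<lambda>\<omega>. f (A (Suc n) \<omega>, B (Suc n) \<omega>)"
    have "(\<lambda>\<omega>. (A (Suc n) \<omega>, B (Suc n) \<omega>)) \<in> measurable M (count_space UNIV)"
      by (intro measurable_count_space_pairI) measurable
    then have Y [measurable]: "?Y \<in> borel_measurable M"
      by (rule measurable_compose) simp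
    have intY: "integrable M ?Y"
      by (rule integrable_const_bound[where B = C]) (use f in auto)
    have YAB: "?Y \<in> borel_measurable AB"
      by (rule measurable_compose[OF ABm]) simp
    have "indep_var borel ?Y borel \<psi>"
      unfolding indep_var_eq
    proof (intro conjI)
      \<comment> \<open>The two variables generate sub-sigma-algebras of independent ones, and
        independence passes to smaller families.\<close>
      have "sigma_sets (space M) {?Y -` A \<inter> space M |A. A \<in> sets borel} \<subseteq> sets AB"
        using sets_image_in_sets[of AB, OF _ YAB] by (simp add: AB_def sets_vimage_algebra)
      moreover have "sigma_sets (space M) {\<psi> -` A \<inter> space M |A. A \<in> sets borel} \<subseteq> sets (past_NX (Suc n))"
        using sets_image_in_sets[of "past_NX (Suc n)", OF _ \<psi>] by (simp add: sets_vimage_algebra)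
      ultimately show "indep_set (sigma_sets (space M) {?Y -` A \<inter> space M |A. A \<in> sets borel})
          (sigma_sets (space M) {\<psi> -` A \<inter> space M |A. A \<in> sets borel})"
        using ind unfolding indep_set_def
        by (elim indep_sets_mono_sets) (auto split: bool.split)
    qed measurable
    then have "(\<integral>\<omega>. ?Y \<omega> * \<psi> \<omega> \<partial>M) = (\<integral>\<omega>. ?Y \<omega> \<partial>M) * (\<integral>\<omega>. \<psi> \<omega> \<partial>M)"
      by (rule indep_var_lebesgue_integral) (use int intY in auto)
    then show ?thesis by (simp add: mult.commute)
  qed
  have "AE \<omega> in M. \<bar>real (A (Suc n) \<omega>)\<bar> \<le> real C" "AE \<omega> in M. \<bar>real (B (Suc n) \<omega>)\<bar> \<le> real C"
    using AE_step[of n] by (eventually_elim; simp)+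
  then show "(\<integral>\<omega>. \<psi> \<omega> * real (A (Suc n) \<omega>) \<partial>M) = (\<integral>\<omega>. real (A (Suc n) \<omega>) \<partial>M) * (\<integral>\<omega>. \<psi> \<omega> \<partial>M)"
    and "(\<integral>\<omega>. \<psi> \<omega> * real (B (Suc n) \<omega>) \<partial>M) = (\<integral>\<omega>. real (B (Suc n) \<omega>) \<partial>M) * (\<integral>\<omega>. \<psi> \<omega> \<partial>M)"
    using *[of "\<lambda>x. real (fst x)"] *[of "\<lambda>x. real (snd x)"] by simp_all
qed

section \<open>One-step contraction of the ratio K/H\<close>

lemma real_H_ge_1: "real (H n \<omega>) \<ge> 1" and real_K_ge_1: "real (K n \<omega>) \<ge> 1"
  using H_pos[of n \<omega>] K_pos[of n \<omega>] by linarith+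

lemma AE_step_real:
  "AE \<omega> in M. real (A (Suc n) \<omega>) \<ge> 1 \<and> real (A (Suc n) \<omega>) \<le> C \<and> real (B (Suc n) \<omega>) \<le> C \<and>
    1 \<le> real (N (Suc n) \<omega>) \<and> real (N (Suc n) \<omega>) \<le> C \<and> real (X (Suc n) \<omega>) \<le> real (N (Suc n) \<omega>) \<and>
    real (S n \<omega>) \<le> real L * real (Suc n) \<and>
    real (H (Suc n) \<omega>) = real (H n \<omega>) + real (A (Suc n) \<omega>) * real (X (Suc n) \<omega>) \<and>
    real (K (Suc n) \<omega>) = real (K n \<omega>) + real (B (Suc n) \<omega>) * (real (N (Suc n) \<omega>) - real (X (Suc n) \<omega>)) \<and>
    real (S n \<omega>) = real (H n \<omega>) + real (K n \<omega>)"
  using AE_step[of n]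
proof eventually_elim
  case (elim \<omega>)
  have S: "real (S n \<omega>) \<le> real L * real (Suc n)"
    using elim by (simp only: of_nat_le_iff of_nat_mult[symmetric])
  show ?case using elim by (intro conjI S) (auto simp: H_Suc K_Suc S_eq of_nat_diff)
qed

lemma L_pos: "real L > 0" using a_ge_1 by (simp only: of_nat_0_less_iff)

text \<open>An arbitrary event \<open>D\<close> of the past serves both as test event for the
  supermartingale inequality and as carrier of the restriction \<open>h0 \<le> H n\<close>.
  Averaging goes from the last variable of the round backwards: \<open>A\<close> or \<open>B\<close>
  given the sample, then \<open>X\<close> given the sample size. \<open>N\<close> is not averaged
  but bounded below by \<open>1\<close>.\<close>

lemma integral_ratio_step:
  assumes D: "D \<in> sets (past (Suc n))" and DH: "\<And>\<omega>. \<omega> \<in> D \<Longrightarrow> h0 \<le> real (H n \<omega>)" and h0: "h0 \<ge> 1"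
    and drift: "(\<integral>\<omega>. real (B (Suc n) \<omega>) \<partial>M) - (1 - C\<^sup>2 / h0) * (\<integral>\<omega>. real (A (Suc n) \<omega>) \<partial>M) \<le> - \<delta>"
    and "\<delta> > 0"
  shows "(\<integral>\<omega>. indicator D \<omega> * (real (K (Suc n) \<omega>) / real (H (Suc n) \<omega>)) \<partial>M)
    \<le> (1 - (\<delta> / L) / real (Suc n)) * (\<integral>\<omega>. indicator D \<omega> * (real (K n \<omega>) / real (H n \<omega>)) \<partial>M)"
    (is "?lhs \<le> _")
proof -
  let ?A = "\<lambda>\<omega>. real (A (Suc n) \<omega>)" and ?B = "\<lambda>\<omega>. real (B (Suc n) \<omega>)"
  let ?N = "\<lambda>\<omega>. real (N (Suc n) \<omega>)" and ?X = "\<lambda>\<omega>. real (X (Suc n) \<omega>)"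
  let ?H = "\<lambda>\<omega>. real (H n \<omega>)" and ?K = "\<lambda>\<omega>. real (K n \<omega>)" and ?S = "\<lambda>\<omega>. real (S n \<omega>)"
  let ?I = "indicator D :: 'a \<Rightarrow> real"
  define c where "c = real L * real (Suc n)"
  define r where "r = 1 - C\<^sup>2 / h0"
  define V where "V \<omega> = ?I \<omega> * (?K \<omega> / ?H \<omega>)" for \<omega>
  \<comment> \<open>The common value of the two averaged first-order terms.\<close>
  define U where "U \<omega> = ?N \<omega> / ?S \<omega> * V \<omega>" for \<omega>
  have c: "c > 0" using L_pos by (simp add: c_def)
  have D_NX: "D \<in> sets (past_NX (Suc n))" "D \<in> sets (past_N (Suc n))" "D \<in> sets M"
    using D subalgebra_past_N_past[of "Suc n"] subalgebra_past_NX_past_N[of "Suc n"] subalgebra_past[of "Suc n"]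
    unfolding subalgebra_def by auto
  note [measurable] = D_NX
    balls_measurable[OF hist_measurable lessI]
    balls_measurable[OF hist_measurable_past_N lessI]
    balls_measurable[OF hist_measurable_past_NX lessI]
    N_measurable_past_N N_measurable_past_NX X_measurable_past_NX
    measurable_N[of "Suc n", simplified] measurable_X[of "Suc n", simplified]
    measurable_A[of "Suc n", simplified] measurable_B[of "Suc n", simplified]
  have ae: "AE \<omega> in M. 1 \<le> ?A \<omega> \<and> ?A \<omega> \<le> C \<and> ?B \<omega> \<le> C \<and> 1 \<le> ?N \<omega> \<and> ?N \<omega> \<le> C \<and> ?X \<omega> \<le> ?N \<omega> \<and>
      ?H \<omega> + ?K \<omega> \<le> c \<and> ?S \<omega> = ?H \<omega> + ?K \<omega> \<and>
      real (H (Suc n) \<omega>) = ?H \<omega> + ?A \<omega> * ?X \<omega> \<and>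
      real (K (Suc n) \<omega>) = ?K \<omega> + ?B \<omega> * (?N \<omega> - ?X \<omega>)"
    using AE_step_real[of n] by eventually_elim (auto simp: c_def)
  have frac1: "0 \<le> k / h \<and> k / h \<le> k" if "1 \<le> h" "0 \<le> k" for h k :: real
    using that by (auto simp: divide_le_eq mult_left_mono[of 1 h k, simplified])
  have V_bd: "0 \<le> V \<omega> \<and> V \<omega> \<le> ?K \<omega>" for \<omega>
    using frac1[OF real_H_ge_1[of n \<omega>], of "?K \<omega>"] by (auto simp: V_def split: split_indicator)

  have bdX: "AE \<omega> in M. \<bar>?I \<omega> * (?K \<omega> / (?H \<omega>)\<^sup>2)\<bar> \<le> c"
    using ae
  proof eventually_elim
    case (elim \<omega>)
    have "(?H \<omega>)\<^sup>2 \<ge> 1" using real_H_ge_1 by simp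
    from frac1[OF this, of "?K \<omega>"] show ?case
      using elim real_H_ge_1[of n \<omega>] by (auto split: split_indicator)
  qed
  have bd1: "AE \<omega> in M. \<bar>?I \<omega> * (1 / ?H \<omega>)\<bar> \<le> 1"
    by (rule AE_I2) (use real_H_ge_1 in \<open>auto split: split_indicator simp: divide_le_eq\<close>)
  \<comment> \<open>The mean \<open>N * H / S\<close> of \<open>X\<close> cancels one power of
    \<open>H\<close> in \<open>K / H^2\<close>, which leaves \<open>U\<close>.\<close>
  have eqA0: "(\<integral>\<omega>. ?I \<omega> * (?K \<omega> / (?H \<omega>)\<^sup>2) * ?X \<omega> \<partial>M) = (\<integral>\<omega>. U \<omega> \<partial>M)"
    by (subst integral_mult_X[OF _ bdX])
      (auto intro!: Bochner_Integration.integral_cong simp: U_def V_def power2_eq_square mult_ac)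
  have intU: "integrable M U"
  proof (rule integrable_const_bound[where B = "C * c"])
    show "AE \<omega> in M. norm (U \<omega>) \<le> C * c"
      using ae
    proof eventually_elim
      case (elim \<omega>)
      have S1: "?S \<omega> \<ge> 1" using elim real_H_ge_1[of n \<omega>] real_K_ge_1[of n \<omega>] by linarith
      have "0 \<le> ?N \<omega> / ?S \<omega>" "?N \<omega> / ?S \<omega> \<le> C" using frac1[OF S1, of "?N \<omega>"] elim by auto
      moreover have "0 \<le> V \<omega>" "V \<omega> \<le> c" using V_bd[of \<omega>] elim real_H_ge_1[of n \<omega>] by linarith+
      ultimately have "0 \<le> U \<omega>" "U \<omega> \<le> real C * c"
        unfolding U_def using c by (intro mult_nonneg_nonneg mult_mono; simp)+
      then show ?case by simp
    qed
  qed (unfold U_def V_def, measurable)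
  have intV: "integrable M V"
  proof (rule integrable_const_bound[where B = c])
    show "AE \<omega> in M. norm (V \<omega>) \<le> c"
      using ae
    proof eventually_elim
      case (elim \<omega>)
      then show ?case using V_bd[of \<omega>] real_H_ge_1[of n \<omega>] by auto
    qed
  qed (unfold V_def, measurable)
  have intN: "integrable M (\<lambda>\<omega>. ?I \<omega> * (1 / ?H \<omega>) * ?N \<omega>)"
    and intX: "integrable M (\<lambda>\<omega>. ?I \<omega> * (1 / ?H \<omega>) * ?X \<omega>)"
    and intNS: "integrable M (\<lambda>\<omega>. ?I \<omega> * (1 / ?H \<omega>) * (?N \<omega> * ?H \<omega> / ?S \<omega>))"
  proof -
    show "integrable M (\<lambda>\<omega>. ?I \<omega> * (1 / ?H \<omega>) * ?N \<omega>)"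
    proof (rule integrable_const_bound[where B = C])
      show "AE \<omega> in M. norm (?I \<omega> * (1 / ?H \<omega>) * ?N \<omega>) \<le> C"
        using ae
      proof eventually_elim
        case (elim \<omega>)
        then show ?case
          using frac1[OF real_H_ge_1[of n \<omega>], of "?N \<omega>"] by (auto split: split_indicator)
      qed
    qed measurable
    show "integrable M (\<lambda>\<omega>. ?I \<omega> * (1 / ?H \<omega>) * ?X \<omega>)"
    proof (rule integrable_const_bound[where B = C])
      show "AE \<omega> in M. norm (?I \<omega> * (1 / ?H \<omega>) * ?X \<omega>) \<le> C"
        using ae
      proof eventually_elim
        case (elim \<omega>)
        then show ?case
          using frac1[OF real_H_ge_1[of n \<omega>], of "?X \<omega>"] by (auto split: split_indicator)
      qed
    qed measurable
    show "integrable M (\<lambda>\<omega>. ?I \<omega> * (1 / ?H \<omega>) * (?N \<omega> * ?H \<omega> / ?S \<omega>))"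
    proof (rule integrable_const_bound[where B = C])
      show "AE \<omega> in M. norm (?I \<omega> * (1 / ?H \<omega>) * (?N \<omega> * ?H \<omega> / ?S \<omega>)) \<le> C"
        using ae
      proof eventually_elim
        case (elim \<omega>)
        have S1: "?S \<omega> \<ge> 1" using elim real_H_ge_1[of n \<omega>] real_K_ge_1[of n \<omega>] by linarith
        have "(1 / ?H \<omega>) * (?N \<omega> * ?H \<omega> / ?S \<omega>) = ?N \<omega> / ?S \<omega>"
          using real_H_ge_1[of n \<omega>] by simp
        then show ?case
          using frac1[OF S1, of "?N \<omega>"] elim by (auto split: split_indicator)
      qed
    qed measurable
  qed
  \<comment> \<open>Here the cancellation is \<open>N / H - N / S = (N / S) * (K / H)\<close>, from
    \<open>S = H + K\<close>.\<close>
  have eqB0: "(\<integral>\<omega>. ?I \<omega> * (1 / ?H \<omega>) * (?N \<omega> - ?X \<omega>) \<partial>M) = (\<integral>\<omega>. U \<omega> \<partial>M)"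
  proof -
    have "(\<integral>\<omega>. ?I \<omega> * (1 / ?H \<omega>) * (?N \<omega> - ?X \<omega>) \<partial>M)
        = (\<integral>\<omega>. ?I \<omega> * (1 / ?H \<omega>) * ?N \<omega> \<partial>M) - (\<integral>\<omega>. ?I \<omega> * (1 / ?H \<omega>) * ?X \<omega> \<partial>M)"
      by (subst Bochner_Integration.integral_diff[OF intN intX, symmetric]) (simp only: right_diff_distrib)
    also have "(\<integral>\<omega>. ?I \<omega> * (1 / ?H \<omega>) * ?X \<omega> \<partial>M)
        = (\<integral>\<omega>. ?I \<omega> * (1 / ?H \<omega>) * (?N \<omega> * ?H \<omega> / ?S \<omega>) \<partial>M)"
      by (rule integral_mult_X[OF _ bd1]) measurable
    also have "(\<integral>\<omega>. ?I \<omega> * (1 / ?H \<omega>) * ?N \<omega> \<partial>M) - \<dots>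
        = (\<integral>\<omega>. ?I \<omega> * (1 / ?H \<omega>) * ?N \<omega> - ?I \<omega> * (1 / ?H \<omega>) * (?N \<omega> * ?H \<omega> / ?S \<omega>) \<partial>M)"
      using intN intNS by simp
    also have "\<dots> = (\<integral>\<omega>. U \<omega> \<partial>M)"
    proof (rule Bochner_Integration.integral_cong[OF refl])
      fix \<omega>
      have "real (S n \<omega>) = ?H \<omega> + ?K \<omega>" by (simp add: S_eq)
      then show "?I \<omega> * (1 / ?H \<omega>) * ?N \<omega> - ?I \<omega> * (1 / ?H \<omega>) * (?N \<omega> * ?H \<omega> / ?S \<omega>) = U \<omega>"
        using real_H_ge_1[of n \<omega>] real_K_ge_1[of n \<omega>]
        by (simp add: U_def V_def field_simps)
    qed
    finally show ?thesis .
  qed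
  have eqA: "(\<integral>\<omega>. ?I \<omega> * (?K \<omega> / (?H \<omega>)\<^sup>2) * ?X \<omega> * ?A \<omega> \<partial>M) = (\<integral>\<omega>. ?A \<omega> \<partial>M) * (\<integral>\<omega>. U \<omega> \<partial>M)"
    and intA: "integrable M (\<lambda>\<omega>. ?I \<omega> * (?K \<omega> / (?H \<omega>)\<^sup>2) * ?X \<omega> * ?A \<omega>)"
  proof -
    have bd: "AE \<omega> in M. \<bar>?I \<omega> * (?K \<omega> / (?H \<omega>)\<^sup>2) * ?X \<omega>\<bar> \<le> c * C"
      using bdX ae
    proof eventually_elim
      case (elim \<omega>)
      then show ?case unfolding abs_mult[of _ "?X \<omega>"] using c by (intro mult_mono) auto
    qed
    show "(\<integral>\<omega>. ?I \<omega> * (?K \<omega> / (?H \<omega>)\<^sup>2) * ?X \<omega> * ?A \<omega> \<partial>M) = (\<integral>\<omega>. ?A \<omega> \<partial>M) * (\<integral>\<omega>. U \<omega> \<partial>M)"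
      unfolding eqA0[symmetric] by (rule integral_mult_reinforcement(1)[OF _ bd]) measurable
    show "integrable M (\<lambda>\<omega>. ?I \<omega> * (?K \<omega> / (?H \<omega>)\<^sup>2) * ?X \<omega> * ?A \<omega>)"
    proof (rule integrable_const_bound[where B = "c * C * C"])
      show "AE \<omega> in M. norm (?I \<omega> * (?K \<omega> / (?H \<omega>)\<^sup>2) * ?X \<omega> * ?A \<omega>) \<le> c * C * C"
        using bd ae
      proof eventually_elim
        case (elim \<omega>)
        then show ?case unfolding norm_mult[of _ "?A \<omega>"] using c by (intro mult_mono) auto
      qed
    qed measurable
  qed
  have eqB: "(\<integral>\<omega>. ?I \<omega> * (1 / ?H \<omega>) * (?N \<omega> - ?X \<omega>) * ?B \<omega> \<partial>M) = (\<integral>\<omega>. ?B \<omega> \<partial>M) * (\<integral>\<omega>. U \<omega> \<partial>M)"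
    and intB: "integrable M (\<lambda>\<omega>. ?I \<omega> * (1 / ?H \<omega>) * (?N \<omega> - ?X \<omega>) * ?B \<omega>)"
  proof -
    have bd: "AE \<omega> in M. \<bar>?I \<omega> * (1 / ?H \<omega>) * (?N \<omega> - ?X \<omega>)\<bar> \<le> 1 * real C"
      using bd1 ae
    proof eventually_elim
      case (elim \<omega>)
      then show ?case unfolding abs_mult[of _ "?N \<omega> - ?X \<omega>"] by (intro mult_mono) auto
    qed
    show "(\<integral>\<omega>. ?I \<omega> * (1 / ?H \<omega>) * (?N \<omega> - ?X \<omega>) * ?B \<omega> \<partial>M) = (\<integral>\<omega>. ?B \<omega> \<partial>M) * (\<integral>\<omega>. U \<omega> \<partial>M)"
      unfolding eqB0[symmetric] by (rule integral_mult_reinforcement(2)[OF _ bd]) measurable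
    show "integrable M (\<lambda>\<omega>. ?I \<omega> * (1 / ?H \<omega>) * (?N \<omega> - ?X \<omega>) * ?B \<omega>)"
    proof (rule integrable_const_bound[where B = "real C * real C"])
      show "AE \<omega> in M. norm (?I \<omega> * (1 / ?H \<omega>) * (?N \<omega> - ?X \<omega>) * ?B \<omega>) \<le> real C * real C"
        using bd ae
      proof eventually_elim
        case (elim \<omega>)
        then show ?case unfolding norm_mult[of _ "?B \<omega>"] by (intro mult_mono) auto
      qed
    qed measurable
  qed
  let ?R = "\<lambda>\<omega>. V \<omega> + ?I \<omega> * (1 / ?H \<omega>) * (?N \<omega> - ?X \<omega>) * ?B \<omega>
      - r * (?I \<omega> * (?K \<omega> / (?H \<omega>)\<^sup>2) * ?X \<omega> * ?A \<omega>)"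
  have intR: "integrable M ?R"
    by (intro Bochner_Integration.integrable_diff Bochner_Integration.integrable_add
        integrable_mult_right intV intA intB)
  have pw: "AE \<omega> in M. ?I \<omega> * (real (K (Suc n) \<omega>) / real (H (Suc n) \<omega>)) \<le> ?R \<omega>"
    using ae
  proof eventually_elim
    case (elim \<omega>)
    show ?case
    proof (cases "\<omega> \<in> D")
      case True
      \<comment> \<open>The increment of \<open>H\<close> is at most \<open>C * C\<close>; this is
        the origin of \<open>C^2\<close> in the drift condition.\<close>
      have "?A \<omega> * ?X \<omega> \<le> real C * real C" using elim by (intro mult_mono) auto
      then have "(?K \<omega> + ?B \<omega> * (?N \<omega> - ?X \<omega>)) / (?H \<omega> + ?A \<omega> * ?X \<omega>)
          \<le> ?K \<omega> / ?H \<omega> + ?B \<omega> * (?N \<omega> - ?X \<omega>) / ?H \<omega>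
            - (1 - C\<^sup>2 / h0) * (?K \<omega> * (?A \<omega> * ?X \<omega>) / (?H \<omega>)\<^sup>2)"
        using elim h0 DH[OF True] by (intro ratio_step_bound) (auto simp: power2_eq_square)
      then show ?thesis using True elim by (simp add: V_def r_def mult_ac)
    qed (simp add: V_def)
  qed
  have "?lhs \<le> (\<integral>\<omega>. ?R \<omega> \<partial>M)"
  proof (rule integral_mono_AE[OF _ intR pw])
    show "integrable M (\<lambda>\<omega>. ?I \<omega> * (real (K (Suc n) \<omega>) / real (H (Suc n) \<omega>)))"
    \<comment> \<open>The left-hand side is nonnegative, so the pointwise upper bound
      \<open>?R\<close> also dominates its absolute value.\<close>
    proof (rule Bochner_Integration.integrable_bound[OF intR])
      show "AE \<omega> in M. norm (?I \<omega> * (real (K (Suc n) \<omega>) / real (H (Suc n) \<omega>))) \<le> norm (?R \<omega>)"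
        using pw by eventually_elim (auto split: split_indicator)
    qed measurable
  qed
  also have "\<dots> = (\<integral>\<omega>. V \<omega> \<partial>M) + ((\<integral>\<omega>. ?B \<omega> \<partial>M) - r * (\<integral>\<omega>. ?A \<omega> \<partial>M)) * (\<integral>\<omega>. U \<omega> \<partial>M)"
    using intV intA intB by (simp only: Bochner_Integration.integral_diff Bochner_Integration.integral_add
        Bochner_Integration.integrable_add integrable_mult_right integral_mult_right_zero eqA eqB)
      (simp add: algebra_simps)
  also have "\<dots> \<le> (\<integral>\<omega>. V \<omega> \<partial>M) + (- \<delta>) * (\<integral>\<omega>. U \<omega> \<partial>M)"
    using drift V_bd by (intro add_left_mono mult_right_mono) (auto simp: r_def U_def)
  also have "\<dots> \<le> (\<integral>\<omega>. V \<omega> \<partial>M) - \<delta> * ((1 / c) * (\<integral>\<omega>. V \<omega> \<partial>M))"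
  proof -
    \<comment> \<open>\<open>N \<ge> 1\<close> and \<open>S \<le> c\<close> give
      \<open>U \<ge> V / c\<close>, which turns the negative drift into a contraction of
      \<open>V\<close> itself.\<close>
    have "(\<integral>\<omega>. (1 / c) * V \<omega> \<partial>M) \<le> (\<integral>\<omega>. U \<omega> \<partial>M)"
    proof (rule integral_mono_AE)
      show "AE \<omega> in M. (1 / c) * V \<omega> \<le> U \<omega>"
        using ae
      proof eventually_elim
        case (elim \<omega>)
        then have "1 / c \<le> ?N \<omega> / ?S \<omega>"
          using real_H_ge_1[of n \<omega>] real_K_ge_1[of n \<omega>] by (intro frac_le) auto
        then show ?case unfolding U_def using V_bd by (intro mult_right_mono) auto
      qed
    qed (use intV intU in auto)
    then have "(1 / c) * (\<integral>\<omega>. V \<omega> \<partial>M) \<le> (\<integral>\<omega>. U \<omega> \<partial>M)" by simp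
    from mult_left_mono[OF this, of \<delta>] \<open>\<delta> > 0\<close> show ?thesis by linarith
  qed
  also have "\<dots> = (1 - (\<delta> / L) / real (Suc n)) * (\<integral>\<omega>. V \<omega> \<partial>M)"
    by (simp add: c_def field_simps del: of_nat_Suc of_nat_add of_nat_mult)
  finally show ?thesis by (simp add: V_def)
qed

section \<open>Unbounded growth of color A\<close>

text \<open>While \<open>H n < h\<close>, the mean number of sampled balls of color A is
  \<open>N * H / S\<close>, at least a harmonic term because \<open>N\<close> and \<open>H\<close>
  are at least \<open>1\<close>. Hence the mean of the shortfall \<open>W\<close> contracts to
  \<open>0\<close>. If \<open>H\<close> stayed below \<open>h\<close> forever, \<open>W\<close>
  would be at least \<open>1\<close> at all times, so the probability of that is at most every mean
  of \<open>W\<close>.\<close>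

lemma AE_H_ge: "AE \<omega> in M. \<exists>n. h \<le> H n \<omega>"
proof (cases "h = 0")
  case False
  \<comment> \<open>Subtraction on \<open>nat\<close> makes this the positive part of
    \<open>h - H n\<close>.\<close>
  define W where "W n \<omega> = real (h - H n \<omega>)" for n \<omega>
  \<comment> \<open>The three factors come from \<open>W \<le> h\<close>, from
    \<open>X \<le> C\<close> and from \<open>S n \<le> L * Suc n\<close>.\<close>
  define \<kappa> where "\<kappa> = 1 / (real h * real C * real L)"
  have W_meas: "W n \<in> borel_measurable M" for n
  proof -
    note [measurable] = balls_measurable[OF hist_measurable lessI]
    show ?thesis unfolding W_def by measurable
  qed
  have W_bd: "0 \<le> W n \<omega>" "W n \<omega> \<le> real h" for n \<omega>
    by (auto simp: W_def)
  have W_int: "integrable M (W n)" for n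
    by (rule integrable_const_bound[where B = h]) (use W_meas W_bd in \<open>auto simp: abs_of_nonneg\<close>)
  have step: "(\<integral>\<omega>. W (Suc n) \<omega> \<partial>M) \<le> (1 - \<kappa> / real (Suc n)) * (\<integral>\<omega>. W n \<omega> \<partial>M)" for n
  proof -
    let ?D = "{\<omega> \<in> space M. H n \<omega> < h}"
    let ?I = "indicator ?D :: 'a \<Rightarrow> real"
    let ?X = "\<lambda>\<omega>. real (X (Suc n) \<omega>)"
    let ?Z = "\<lambda>\<omega>. real (N (Suc n) \<omega>) * real (H n \<omega>) / real (S n \<omega>)"
    note [measurable] = balls_measurable[OF hist_measurable lessI]
      balls_measurable[OF hist_measurable_past_N lessI]
      measurable_N[of "Suc n", simplified] measurable_X[of "Suc n", simplified]
    have "{\<omega> \<in> space (past_N (Suc n)). H n \<omega> < h} \<in> sets (past_N (Suc n))" by measurable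
    then have [measurable]: "?D \<in> sets (past_N (Suc n))" by simp
    have [measurable]: "?D \<in> events" by measurable
    have intX: "integrable M (\<lambda>\<omega>. ?I \<omega> * ?X \<omega>)"
    proof (rule integrable_const_bound[where B = C])
      show "AE \<omega> in M. norm (?I \<omega> * ?X \<omega>) \<le> C"
        using AE_step_real[of n] by eventually_elim (auto split: split_indicator)
    qed measurable
    have intZ: "integrable M (\<lambda>\<omega>. ?I \<omega> * ?Z \<omega>)"
    proof (rule integrable_const_bound[where B = C])
      show "AE \<omega> in M. norm (?I \<omega> * ?Z \<omega>) \<le> C"
        using AE_step_real[of n]
      proof eventually_elim
        case (elim \<omega>)
        have "real (N (Suc n) \<omega>) * (real (H n \<omega>) / real (S n \<omega>)) \<le> real C * 1"
          using elim real_H_ge_1[of n \<omega>] by (intro mult_mono) (auto simp: divide_le_eq)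
        then show ?case by (auto split: split_indicator)
      qed
    qed measurable
    have "(\<integral>\<omega>. W (Suc n) \<omega> \<partial>M) \<le> (\<integral>\<omega>. W n \<omega> - (1 / C) * (?I \<omega> * ?X \<omega>) \<partial>M)"
    proof (rule integral_mono_AE)
      show "AE \<omega> in M. W (Suc n) \<omega> \<le> W n \<omega> - (1 / C) * (?I \<omega> * ?X \<omega>)"
        using AE_step[of n]
      proof eventually_elim
        case (elim \<omega>)
        have mono: "W (Suc n) \<omega> \<le> W n \<omega>" by (simp add: W_def H_Suc)
        show ?case
        \<comment> \<open>If some ball of color A is drawn below the level \<open>h\<close>, then
          \<open>W\<close> drops by at least \<open>1\<close>, hence by at least
          \<open>X / C\<close>; otherwise the subtracted term is \<open>0\<close>.\<close>
        proof (cases "\<omega> \<in> ?D \<and> X (Suc n) \<omega> \<ge> 1")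
          case True
          have "1 * 1 \<le> A (Suc n) \<omega> * X (Suc n) \<omega>" using elim True by (intro mult_mono) auto
          then have "H n \<omega> + 1 \<le> H (Suc n) \<omega>" unfolding H_Suc by linarith
          then have "h - H (Suc n) \<omega> + 1 \<le> h - H n \<omega>" using True by auto
          then have "W (Suc n) \<omega> + 1 \<le> W n \<omega>" by (simp add: W_def)
          moreover have "(1 / C) * ?X \<omega> \<le> 1" using elim by (auto simp: divide_le_eq)
          ultimately show ?thesis using True by simp
        next
          case False
          then show ?thesis using mono by (auto split: split_indicator simp: not_le)
        qed
      qed
    qed (use W_int intX in auto)
    also have "\<dots> = (\<integral>\<omega>. W n \<omega> \<partial>M) - (1 / C) * (\<integral>\<omega>. ?I \<omega> * ?X \<omega> \<partial>M)"
      using W_int intX by (simp only: Bochner_Integration.integral_diff integrable_mult_right integral_mult_right_zero)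
    also have "(\<integral>\<omega>. ?I \<omega> * ?X \<omega> \<partial>M) = (\<integral>\<omega>. ?I \<omega> * ?Z \<omega> \<partial>M)"
      by (rule integral_mult_X[where c = 1]) (auto split: split_indicator)
    also have "(\<integral>\<omega>. W n \<omega> \<partial>M) - (1 / C) * (\<integral>\<omega>. ?I \<omega> * ?Z \<omega> \<partial>M)
        \<le> (\<integral>\<omega>. W n \<omega> \<partial>M) - (1 / C) * (\<integral>\<omega>. 1 / (real h * (real L * real (Suc n))) * W n \<omega> \<partial>M)"
    proof (intro diff_left_mono mult_left_mono integral_mono_AE)
      show "AE \<omega> in M. 1 / (real h * (real L * real (Suc n))) * W n \<omega> \<le> ?I \<omega> * ?Z \<omega>"
        using AE_step_real[of n] AE_space
      proof eventually_elim
        case (elim \<omega>)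
        show ?case
        proof (cases "\<omega> \<in> ?D")
          case True
          have "1 / (real h * (real L * real (Suc n))) * W n \<omega> = (W n \<omega> / real h) * (1 / (real L * real (Suc n)))"
            by simp
          also have "\<dots> \<le> 1 * (1 / (real L * real (Suc n)))"
            using False W_bd L_pos by (intro mult_right_mono) (auto simp: divide_le_eq)
          also have "\<dots> \<le> 1 * (1 / real (S n \<omega>))"
            using elim real_H_ge_1[of n \<omega>] real_K_ge_1[of n \<omega>] by (intro mult_left_mono frac_le) auto
          also have "\<dots> \<le> (real (N (Suc n) \<omega>) * real (H n \<omega>)) * (1 / real (S n \<omega>))"
            using elim real_H_ge_1[of n \<omega>] mult_mono[of 1 "real (N (Suc n) \<omega>)" 1 "real (H n \<omega>)"]
            by (intro mult_right_mono) auto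
          finally show ?thesis using True by simp
        next
          case False
          then show ?thesis using elim by (auto simp: W_def)
        qed
      qed
    qed (use W_int intZ in auto)
    also have "\<dots> = (1 - \<kappa> / real (Suc n)) * (\<integral>\<omega>. W n \<omega> \<partial>M)"
      by (simp add: \<kappa>_def algebra_simps del: of_nat_Suc of_nat_add of_nat_mult)
    finally show ?thesis .
  qed
  have "\<kappa> > 0" using False C_pos L_pos by (simp add: \<kappa>_def del: of_nat_add of_nat_mult)
  then have lim: "(\<lambda>n. \<integral>\<omega>. W n \<omega> \<partial>M) \<longlonglongrightarrow> 0"
    by (rule tendsto_0_of_harmonic_contraction[rotated]) (use step W_bd in auto)
  let ?E = "{\<omega> \<in> space M. \<forall>n. H n \<omega> < h}"
  have H_meas [measurable]: "H n \<in> measurable M (count_space UNIV)" for n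
    by (rule balls_measurable[OF hist_measurable lessI])
  have E [measurable]: "?E \<in> events" by measurable
  have "prob ?E \<le> (\<integral>\<omega>. W n \<omega> \<partial>M)" for n
  proof -
    have "prob ?E = (\<integral>\<omega>. indicator ?E \<omega> \<partial>M)" by (auto intro!: arg_cong[where f = prob])
    also have "\<dots> \<le> (\<integral>\<omega>. W n \<omega> \<partial>M)"
    proof (rule integral_mono[OF _ W_int])
      show "integrable M (indicator ?E :: 'a \<Rightarrow> real)" using E by (auto simp: less_top[symmetric])
      fix \<omega>
      show "indicator ?E \<omega> \<le> W n \<omega>"
      proof (cases "\<omega> \<in> ?E")
        case True
        then have "h - H n \<omega> \<ge> 1" by (auto simp: Suc_le_eq)
        then show ?thesis using True by (simp add: W_def)
      qed (use W_bd in auto)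
    qed
    finally show ?thesis .
  qed
  then have "prob ?E \<le> 0" using lim by (intro LIMSEQ_le_const) auto
  then have "prob ?E = 0" by (simp add: measure_le_0_iff)
  then have "AE \<omega> in M. \<omega> \<notin> ?E" using E prob_eq_0 by blast
  then show ?thesis by (rule AE_mp) (auto simp: not_less intro!: AE_I2)
qed simp

section \<open>Convergence of the ratio and of the proportion\<close>

lemma AE_ratio_tendsto_0:
  assumes h0: "h0 \<ge> 1" and "\<delta> > 0"
    and drift: "\<And>n. n \<ge> n0 \<Longrightarrow>
      (\<integral>\<omega>. real (B (Suc n) \<omega>) \<partial>M) - (1 - C\<^sup>2 / h0) * (\<integral>\<omega>. real (A (Suc n) \<omega>) \<partial>M) \<le> - \<delta>"
  shows "AE \<omega> in M. h0 \<le> real (H m \<omega>) \<longrightarrow> (\<lambda>n. real (K n \<omega>) / real (H n \<omega>)) \<longlonglongrightarrow> 0"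
proof -
  \<comment> \<open>From time \<open>m + n0\<close> on, the event \<open>G\<close> belongs to the
    past and the drift bound holds; monotonicity of \<open>H\<close> keeps the level
    \<open>h0\<close> exceeded on \<open>G\<close>.\<close>
  define k where "k = m + n0"
  define G where "G = {\<omega> \<in> space M. h0 \<le> real (H m \<omega>)}"
  define V where "V n \<omega> = indicator G \<omega> * (real (K n \<omega>) / real (H n \<omega>))" for n \<omega>
  have hist_past: "hist (Suc m) \<in> measurable (past (Suc (n + k))) (history_space (Suc m))" for n
    by (intro hist_measurableI hist_component_measurable[OF hist_measurable_past]) (auto simp: k_def)
  have G_past: "G \<in> sets (past (Suc (n + k)))" for n
  proof -
    note [measurable] = balls_measurable(1)[OF hist_past lessI]
    have "{\<omega> \<in> space (past (Suc (n + k))). h0 \<le> real (H m \<omega>)} \<in> sets (past (Suc (n + k)))"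
      by measurable
    then show ?thesis by (simp add: G_def)
  qed
  have V_past: "V (n + k) \<in> borel_measurable (past (Suc (n + k)))" for n
  proof -
    note [measurable] = G_past balls_measurable[OF hist_measurable_past lessI]
    show ?thesis unfolding V_def by measurable
  qed
  have V_meas: "V (n + k) \<in> borel_measurable M" for n
    using measurable_from_subalg[OF subalgebra_past V_past] .
  have V_nonneg: "V n \<omega> \<ge> 0" for n \<omega>
    by (simp add: V_def)
  have V_int: "integrable M (V (n + k))" for n
  proof (rule integrable_const_bound[where B = "real L * real (Suc (n + k))"])
    show "AE \<omega> in M. norm (V (n + k) \<omega>) \<le> real L * real (Suc (n + k))"
      using AE_step_real[of "n + k"]
    proof eventually_elim
      case (elim \<omega>)
      have "real (K (n + k) \<omega>) / real (H (n + k) \<omega>) \<le> real (K (n + k) \<omega>) / 1"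
        using real_H_ge_1[of "n + k" \<omega>] by (intro frac_le) auto
      then have "V (n + k) \<omega> \<le> real (K (n + k) \<omega>)"
        unfolding V_def by (auto split: split_indicator)
      then show ?case using elim real_H_ge_1[of "n + k" \<omega>] V_nonneg[of "n + k" \<omega>] by (simp only: real_norm_def abs_of_nonneg) linarith
    qed
  qed (rule V_meas)
  have step: "(\<integral>\<omega>. indicator D \<omega> * V (Suc (n + k)) \<omega> \<partial>M)
      \<le> (1 - (\<delta> / L) / real (Suc (n + k))) * (\<integral>\<omega>. indicator D \<omega> * V (n + k) \<omega> \<partial>M)"
    if "D \<in> sets (past (Suc (n + k)))" for n D
  proof -
    have DG: "indicator D \<omega> * V j \<omega> = indicator (D \<inter> G) \<omega> * (real (K j \<omega>) / real (H j \<omega>))" for j \<omega>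
      by (simp add: V_def indicator_inter_arith)
    have "h0 \<le> real (H (n + k) \<omega>)" if "\<omega> \<in> D \<inter> G" for \<omega>
      using that H_mono[of m "n + k" \<omega>] by (auto simp: G_def k_def)
    moreover have "n + k \<ge> n0" by (simp add: k_def)
    ultimately show ?thesis
      unfolding DG using that G_past h0 \<open>\<delta> > 0\<close> drift[of "n + k"]
      by (intro integral_ratio_step) auto
  qed
  have rate: "\<delta> / L > 0" using \<open>\<delta> > 0\<close> L_pos by (rule divide_pos_pos)
  have "AE \<omega> in M. (\<lambda>n. V (n + k) \<omega>) \<longlonglongrightarrow> 0"
  \<comment> \<open>Time is shifted by \<open>k\<close> so that adaptedness to the filtration holds
    at every index; before \<open>m\<close> the event \<open>G\<close> need not belong to the
    past.\<close>
  proof (rule supermartingale_AE_tendsto_0[where F = "\<lambda>n. past (Suc (n + k))" and k = 0])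
    show "subalgebra (past (Suc (Suc n + k))) (past (Suc (n + k)))" for n
      using subalgebra_past_Suc[of "Suc (n + k)"] by simp
    show "(\<integral>\<omega>. indicator D \<omega> * V (Suc n + k) \<omega> \<partial>M) \<le> (\<integral>\<omega>. indicator D \<omega> * V (n + k) \<omega> \<partial>M)"
      if "D \<in> sets (past (Suc (n + k)))" for n D
    proof -
      have "0 \<le> (\<integral>\<omega>. indicator D \<omega> * V (n + k) \<omega> \<partial>M)"
        using V_nonneg by (intro integral_nonneg_AE AE_I2) auto
      moreover have "0 \<le> (\<delta> / L) / real (Suc (n + k))"
        by (rule divide_nonneg_nonneg[OF less_imp_le[OF rate]]) simp
      ultimately have "(1 - (\<delta> / L) / real (Suc (n + k))) * (\<integral>\<omega>. indicator D \<omega> * V (n + k) \<omega> \<partial>M)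
          \<le> 1 * (\<integral>\<omega>. indicator D \<omega> * V (n + k) \<omega> \<partial>M)"
        by (intro mult_right_mono) linarith+
      with step[OF that] show ?thesis by simp
    qed
    \<comment> \<open>The rate \<open>\<delta> / L\<close> over \<open>Suc n\<close> refers to the
      original time, so the contraction is applied to the unshifted means, from \<open>k\<close>
      on.\<close>
    have "(\<lambda>n. \<integral>\<omega>. V n \<omega> \<partial>M) \<longlonglongrightarrow> 0"
    proof (rule tendsto_0_of_harmonic_contraction[OF _ rate])
      fix n assume "n \<ge> k"
      then obtain i where n: "n = i + k" by (metis le_add_diff_inverse2)
      have "space M \<in> sets (past (Suc (i + k)))"
        using sets.top[of "past (Suc (i + k))"] by simp
      from step[OF this] show "(\<integral>\<omega>. V (Suc n) \<omega> \<partial>M) \<le> (1 - (\<delta> / L) / real (Suc n)) * (\<integral>\<omega>. V n \<omega> \<partial>M)"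
        unfolding n by (simp cong: Bochner_Integration.integral_cong)
    qed (simp add: V_nonneg)
    then show "(\<lambda>n. \<integral>\<omega>. V (n + k) \<omega> \<partial>M) \<longlonglongrightarrow> 0"
      by (rule LIMSEQ_ignore_initial_segment)
  qed (use subalgebra_past V_past V_int V_nonneg in auto)
  then show ?thesis
    using AE_space
  proof eventually_elim
    case (elim \<omega>)
    show ?case
    proof
      assume "h0 \<le> real (H m \<omega>)"
      then have "V n \<omega> = real (K n \<omega>) / real (H n \<omega>)" for n
        using elim by (simp add: V_def G_def)
      with elim have "(\<lambda>n. real (K (n + k) \<omega>) / real (H (n + k) \<omega>)) \<longlonglongrightarrow> 0" by simp
      then show "(\<lambda>n. real (K n \<omega>) / real (H n \<omega>)) \<longlonglongrightarrow> 0"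
        by (rule LIMSEQ_offset)
    qed
  qed
qed

lemma AE_proportion_tendsto_1:
  assumes limA: "(\<lambda>n. \<integral>\<omega>. real (A n \<omega>) \<partial>M) \<longlonglongrightarrow> mA"
    and limB: "(\<lambda>n. \<integral>\<omega>. real (B n \<omega>) \<partial>M) \<longlonglongrightarrow> mB"
    and "mA > mB"
  shows "AE \<omega> in M. (\<lambda>n. proportion_A a b N X A B n \<omega>) \<longlonglongrightarrow> 1"
proof -
  \<comment> \<open>Half of the gap: with the limiting means the drift tends to
    \<open>- 2 * \<delta>\<close> as the level grows. So \<open>h0\<close> is chosen first, to bring
    it below \<open>- \<delta>\<close>, and then \<open>n0\<close> for this \<open>h0\<close>, by
    convergence of the means.\<close>
  define \<delta> where "\<delta> = (mA - mB) / 2"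
  have "\<delta> > 0" using \<open>mA > mB\<close> by (simp add: \<delta>_def)
  have "((\<lambda>x. mB - (1 - C\<^sup>2 / x) * mA) \<longlongrightarrow> mB - (1 - 0) * mA) at_top"
    by (intro tendsto_intros tendsto_divide_0[OF tendsto_const] filterlim_at_top_imp_at_infinity filterlim_ident)
  then have "eventually (\<lambda>x. mB - (1 - C\<^sup>2 / x) * mA < - \<delta>) at_top"
    by (rule order_tendstoD(2)) (use \<open>mA > mB\<close> in \<open>simp add: \<delta>_def field_simps\<close>)
  then have "eventually (\<lambda>x. mB - (1 - C\<^sup>2 / x) * mA < - \<delta> \<and> x \<ge> 1) at_top"
    by (intro eventually_conj eventually_ge_at_top)
  then obtain h0 :: real where h0: "h0 \<ge> 1" "mB - (1 - C\<^sup>2 / h0) * mA < - \<delta>"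
    by (auto dest!: eventually_happens)
  have "(\<lambda>n. (\<integral>\<omega>. real (B (Suc n) \<omega>) \<partial>M) - (1 - C\<^sup>2 / h0) * (\<integral>\<omega>. real (A (Suc n) \<omega>) \<partial>M))
      \<longlonglongrightarrow> mB - (1 - C\<^sup>2 / h0) * mA"
    by (intro tendsto_intros LIMSEQ_Suc limA limB)
  then have "eventually (\<lambda>n. (\<integral>\<omega>. real (B (Suc n) \<omega>) \<partial>M)
      - (1 - C\<^sup>2 / h0) * (\<integral>\<omega>. real (A (Suc n) \<omega>) \<partial>M) < - \<delta>) sequentially"
    using h0(2) by (rule order_tendstoD(2))
  then obtain n0 where n0: "(\<integral>\<omega>. real (B (Suc n) \<omega>) \<partial>M)
      - (1 - C\<^sup>2 / h0) * (\<integral>\<omega>. real (A (Suc n) \<omega>) \<partial>M) \<le> - \<delta>" if "n \<ge> n0" for n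
    unfolding eventually_sequentially by (meson less_imp_le)
  \<comment> \<open>The time at which \<open>H\<close> reaches \<open>h0\<close> is random; one null
    set for all \<open>m\<close> allows \<open>m\<close> to be picked afterwards, outcome by
    outcome.\<close>
  have "AE \<omega> in M. \<forall>m. h0 \<le> real (H m \<omega>) \<longrightarrow> (\<lambda>n. real (K n \<omega>) / real (H n \<omega>)) \<longlonglongrightarrow> 0"
    unfolding AE_all_countable using AE_ratio_tendsto_0[OF h0(1) \<open>\<delta> > 0\<close> n0] by blast
  then show ?thesis
    using AE_H_ge[of "nat \<lceil>h0\<rceil>"]
  proof eventually_elim
    case (elim \<omega>)
    then obtain m where "nat \<lceil>h0\<rceil> \<le> H m \<omega>" by blast
    then have "h0 \<le> real (H m \<omega>)" by linarith
    then have lim: "(\<lambda>n. real (K n \<omega>) / real (H n \<omega>)) \<longlonglongrightarrow> 0" using elim by blast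
    \<comment> \<open>The proportion is a continuous function of the ratio:
      \<open>H / (H + K) = 1 / (1 + K / H)\<close>.\<close>
    have "(\<lambda>n. 1 / (1 + real (K n \<omega>) / real (H n \<omega>))) \<longlonglongrightarrow> 1 / (1 + 0)"
      by (intro tendsto_intros lim) simp
    moreover have "1 / (1 + real (K n \<omega>) / real (H n \<omega>)) = proportion_A a b N X A B n \<omega>" for n
      using real_H_ge_1[of n \<omega>] real_K_ge_1[of n \<omega>]
      by (simp add: proportion_A_def S_eq field_simps)
    ultimately show ?case by simp
  qed
qed

end

theorem theorem3p2:
  fixes M :: "'w measure"
    and a b :: nat
    and N X A B :: "nat \<Rightarrow> 'w \<Rightarrow> nat"
    and C :: int
    and m\<^sub>A m\<^sub>B :: real
  assumes "urn_model M a b N X A B"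
    and "\<And>n. n \<ge> 1 \<Longrightarrow> AE \<omega> in M. int (max (max (A n \<omega>) (B n \<omega>)) (N n \<omega>)) \<le> C"
    and "(\<lambda>n. \<integral>\<omega>. real (A n \<omega>) \<partial>M) \<longlonglongrightarrow> m\<^sub>A"
    and "m\<^sub>A > 0"
    and "(\<lambda>n. \<integral>\<omega>. real (B n \<omega>) \<partial>M) \<longlonglongrightarrow> m\<^sub>B"
    and "m\<^sub>B > 0"
    and "m\<^sub>A > m\<^sub>B"
  shows "AE \<omega> in M. (\<lambda>n. proportion_A a b N X A B n \<omega>) \<longlonglongrightarrow> 1"
proof -
  interpret urn_model M a b N X A B by fact
  interpret bounded_urn M a b N X A B "nat C"
  proof
    fix n :: nat assume "n \<ge> 1"
    from assms(2)[OF this] show "AE \<omega> in M. A n \<omega> \<le> nat C \<and> B n \<omega> \<le> nat C \<and> N n \<omega> \<le> nat C"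
      by eventually_elim linarith
  qed
  show ?thesis
    using assms(3,5,7) by (rule AE_proportion_tendsto_1)
qed

end
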